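(* Let $\Omega\subset\mathbb{R}^d$ be a uniform domain with admissible Whitney covering $\mathcal W$, let $0<s<1$ and $1\le q\le p<\infty$. For $f\in L^1_{loc}(\Omega)$, $$\left(\sum_{Q\in\mathcal W}\int_Q\left(\int_{5Q}\frac{|f(x)-f(y)|^q}{|x-y|^{sq+d}}dy\right)^{p/q}dx\right)^{1/p}\approx\left(\int_\Omega\left(\int_\Omega\frac{|f(x)-f(y)|^q}{|x-y|^{sq+d}}dy\right)^{p/q}dx\right)^{1/p},$$ with constants independent of $f$.
   Context: $5Q$ is the cube with the same center as $Q$ and side length $5\ell(Q)$ ($\ell(Q)$ side length). $\mathrm D(Q,S)=\ell(Q)+\mathrm{dist}(Q,S)+\ell(S)$, $\mathrm D(Q,\partial\Omega)=\ell(Q)+\mathrm{dist}(Q,\partial\Omega)$. A Whitney covering of $\Omega$ is a family $\mathcal W$ of pairwise disjoint open dyadic cubes whose closures have union $\Omega$, with $C_{\mathcal W}\ell(Q)\le\mathrm D(Q,\partial\Omega)\le4C_{\mathcal W}\ell(Q)$, $\{50Q\}$ of finite overlap, $S\subset5Q\Rightarrow\ell(S)\ge\ell(Q)/2$. A chain from $Q$ to $S$ is a tuple $(Q_1,\dots,Q_M)$ of cubes of $\mathcal W$, $Q_1=Q$, $Q_M=S$, consecutive ones neighbors (closures meeting); it is $\varepsilon$-admissible if $\sum\ell(Q_j)\le\varepsilon^{-1}\mathrm D(Q,S)$ and some $j_0<M$ has $\ell(Q_j)\ge\varepsilon\mathrm D(Q_1,Q_j)$ for $j\le j_0$, $\ell(Q_j)\ge\varepsilon\mathrm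 D(Q_j,Q_M)$ for $j\ge j_0$. $\Omega$ is uniform with admissible covering $\mathcal W$ if for some $\varepsilon>0$ every pair of cubes of $\mathcal W$ is joined by an $\varepsilon$-admissible chain. *)

theory Defs
  imports "HOL-Analysis.Analysis"
begin

text \<open>A cube is represented by its centre c and side length r (a pair (c, r)).
  Q = ocube (c,r) is the open cube, ccube its closure.\<close>

definition ocube :: "'a::euclidean_space \<times> real \<Rightarrow> 'a set" where
  "ocube Q = {x. \<forall>i\<in>Basis. \<bar>x \<bullet> i - fst Q \<bullet> i\<bar> < snd Q / 2}"

definition ccube :: "'a::euclidean_space \<times> real \<Rightarrow> 'a set" where
  "ccube Q = {x. \<forall>i\<in>Basis. \<bar>x \<bullet> i - fst Q \<bullet> i\<bar> \<le> snd Q / 2}"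

definition side :: "'a \<times> real \<Rightarrow> real" where "side Q = snd Q"

definition dil :: "real \<Rightarrow> 'a \<times> real \<Rightarrow> 'a \<times> real" where
  "dil t Q = (fst Q, t * snd Q)"

definition dyadic :: "'a::euclidean_space \<times> real \<Rightarrow> bool" where
  "dyadic Q \<longleftrightarrow> (\<exists>j::int. snd Q = 2 powr j) \<and>
     (\<forall>i\<in>Basis. (fst Q \<bullet> i - snd Q / 2) / snd Q \<in> \<int>)"

definition Dcubes :: "'a::euclidean_space \<times> real \<Rightarrow> 'a \<times> real \<Rightarrow> real" where
  "Dcubes Q S = side Q + setdist (ocube Q) (ocube S) + side S"

definition Dbdry :: "'a::euclidean_space \<times> real \<Rightarrow> 'a set \<Rightarrow> real" where
  "Dbdry Q \<Omega> = side Q + setdist (ocube Q) (frontier \<Omega>)"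

definition whitney_covering :: "'a::euclidean_space set \<Rightarrow> ('a \<times> real) set \<Rightarrow> bool" where
  "whitney_covering \<Omega> W \<longleftrightarrow>
     (\<forall>Q\<in>W. dyadic Q) \<and>
     (\<forall>Q\<in>W. \<forall>S\<in>W. Q \<noteq> S \<longrightarrow> ocube Q \<inter> ocube S = {}) \<and>
     (\<Union>Q\<in>W. ccube Q) = \<Omega> \<and>
     (\<exists>C>0. \<forall>Q\<in>W. C * side Q \<le> Dbdry Q \<Omega> \<and> Dbdry Q \<Omega> \<le> 4 * C * side Q) \<and>
     (\<exists>N::nat. \<forall>x. finite {Q\<in>W. x \<in> ocube (dil 50 Q)} \<and>
                     card {Q\<in>W. x \<in> ocube (dil 50 Q)} \<le> N) \<and>
     (\<forall>Q\<in>W. \<forall>S\<in>W. ocube S \<subseteq> ocube (dil 5 Q) \<longrightarrow> side S \<ge> side Q / 2)"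

definition neighbors :: "'a::euclidean_space \<times> real \<Rightarrow> 'a \<times> real \<Rightarrow> bool" where
  "neighbors Q S \<longleftrightarrow> ccube Q \<inter> ccube S \<noteq> {}"

text \<open>A chain (Q_1,...,Q_M) is a list; list index k corresponds to Q_{k+1}.\<close>
definition is_chain :: "('a::euclidean_space \<times> real) set \<Rightarrow> ('a \<times> real) list
    \<Rightarrow> 'a \<times> real \<Rightarrow> 'a \<times> real \<Rightarrow> bool" where
  "is_chain W ch Q S \<longleftrightarrow> ch \<noteq> [] \<and> set ch \<subseteq> W \<and> hd ch = Q \<and> last ch = S \<and>
     (\<forall>k. Suc k < length ch \<longrightarrow> neighbors (ch ! k) (ch ! Suc k))"

definition admissible_chain :: "real \<Rightarrow> ('a::euclidean_space \<times> real) set \<Rightarrow> ('a \<times> real) list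
    \<Rightarrow> 'a \<times> real \<Rightarrow> 'a \<times> real \<Rightarrow> bool" where
  "admissible_chain \<epsilon> W ch Q S \<longleftrightarrow> is_chain W ch Q S \<and>
     (\<Sum>k<length ch. side (ch ! k)) \<le> Dcubes Q S / \<epsilon> \<and>
     (\<exists>j0. Suc j0 < length ch \<and>
        (\<forall>j\<le>j0. side (ch ! j) \<ge> \<epsilon> * Dcubes (ch ! 0) (ch ! j)) \<and>
        (\<forall>j. j0 \<le> j \<and> j < length ch \<longrightarrow>
              side (ch ! j) \<ge> \<epsilon> * Dcubes (ch ! j) (ch ! (length ch - 1))))"

definition uniform_domain :: "'a::euclidean_space set \<Rightarrow> ('a \<times> real) set \<Rightarrow> bool" where
  "uniform_domain \<Omega> W \<longleftrightarrow> open \<Omega> \<and> connected \<Omega> \<and> \<Omega> \<noteq> {} \<and> \<Omega> \<noteq> UNIV \<and>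
     whitney_covering \<Omega> W \<and>
     (\<exists>\<epsilon>>0. \<forall>Q\<in>W. \<forall>S\<in>W. \<exists>ch. admissible_chain \<epsilon> W ch Q S)"

definition L1_loc :: "'a::euclidean_space set \<Rightarrow> ('a \<Rightarrow> real) \<Rightarrow> bool" where
  "L1_loc \<Omega> f \<longleftrightarrow> (\<forall>K. compact K \<and> K \<subseteq> \<Omega> \<longrightarrow> set_integrable lebesgue K f)"

text \<open>a^t on [0,\<infinity>] for t > 0, with \<infinity>^t = \<infinity>\<close>
definition enn_powr :: "ennreal \<Rightarrow> real \<Rightarrow> ennreal" where
  "enn_powr a t = (if a = top then top else ennreal (enn2real a powr t))"

definition inner_int :: "('a::euclidean_space \<Rightarrow> real) \<Rightarrow> real \<Rightarrow> real \<Rightarrow> 'a set \<Rightarrow> 'a \<Rightarrow> ennreal" where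
  "inner_int f s q A x = set_nn_integral lebesgue A
     (\<lambda>y. ennreal (\<bar>f x - f y\<bar> powr q / norm (x - y) powr (s * q + real DIM('a))))"

end

theory Submission
  imports Defs
begin

text \<open>
  Write \<open>F Q x\<close> for the inner integral over \<open>5Q\<close> and \<open>h Q\<close> for its mean over \<open>Q\<close>; choose \<open>x\<^sub>Q \<in> Q\<close> with
  \<open>F Q x\<^sub>Q \<le> h Q\<close>. For \<open>x \<in> Q\<close> and \<open>y \<in> S\<close> with \<open>y \<notin> 5Q\<close> one has \<open>|x - y| \<approx> D(Q,S)\<close>, and \<open>f x - f y\<close> is split
  through \<open>f x\<^sub>Q\<close> and \<open>f x\<^sub>S\<close>. The oscillation inside one cube, or between neighbors, is bounded by averaging
  over a third point. The difference \<open>f x\<^sub>Q - f x\<^sub>S\<close> is summed along an admissible chain, whose cubes \<open>P\<close> are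
  comparable to \<open>D(Q,P)\<close> or to \<open>D(P,S)\<close>; geometric sums then give
  \<open>\<integral>\<^sub>\<Omega> |f x - f y|\<^sup>q / |x - y|\<^sup>s\<^sup>q\<^sup>+\<^sup>d dy \<le> C (F Q x + T h Q)\<close> with
  \<open>T h Q = (\<Sum>S. (side S / D(Q,S))\<^sup>s\<^sup>+\<^sup>d * h S)\<close>. It remains to bound \<open>T\<close> on the weighted sequence space of exponent
  \<open>r = p/q\<close>. The case \<open>r = 1\<close> is a column sum; for \<open>r > 1\<close> the power of the sum defining \<open>T h Q\<close> is expanded in
  the order of \<open>D(Q,S)\<close>, and the tail beyond \<open>S\<close> is at most a multiple of \<open>T h S\<close>. All of this is done
  for finite families of cubes, where absorption is legitimate, followed by monotone convergence.
\<close>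

subsection \<open>Discrete inequalities\<close>

text \<open>The constants must not depend on the finite family, yet the family has to contain the
  chains that it uses. Hence there are two families: the endpoints of chains lie in
  \<open>V\<close>, while \<open>T\<close> sums over a finite \<open>U\<close> that contains
  \<open>V\<close> and one chain for each pair in \<open>V\<close>. The bounds see only
  disjointness, side comparisons and chain geometry, never the size of \<open>U\<close>. Values of
  \<open>f\<close> at chosen points serve as cube averages because one local estimate then covers
  both the oscillation in a cube and the steps of a chain. The kernel of \<open>T\<close> has the
  exponent s + d although the integrand has s * q + d: Hoelder's inequality along a chain, with
  weights \<open>side P powr s\<close>, contributes the power s * (q - 1) of D(Q,S). The condition q
  \<le> p gives r \<ge> 1, so Jensen's inequality leads back from powers of the means to the local
  integrals. All local integrals run over the part of 5Q inside \<Omega>, where \<open>f\<close> is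
  given.\<close>

lemma powr_above_tangent:
  fixes t a r :: real
  assumes "0 \<le> t" "0 < a" "1 \<le> r"
  shows "a powr r + r * a powr (r - 1) * (t - a) \<le> t powr r"
proof (cases "t = 0")
  case True
  have "a powr r = a powr (r - 1) * a"
    using assms by (simp add: powr_mult_base mult.commute)
  then have "a powr r + r * a powr (r - 1) * (t - a) = (1 - r) * (a powr (r - 1) * a)"
    using True by (simp add: algebra_simps)
  also have "\<dots> \<le> 0"
    using assms by (intro mult_nonpos_nonneg) auto
  finally show ?thesis using True by simp
next
  case False
  then have t: "t > 0" using assms by simp
  \<comment> \<open>Weighted arithmetic-geometric mean inequality for \<open>t powr r\<close> and
    \<open>a powr r\<close> with weights 1/r and 1 - 1/r: convexity without differentiation.\<close>
  have "(t powr r) powr (1 / r) * (a powr r) powr (1 - 1 / r) \<le> 1 / r * t powr r + (1 - 1 / r) * a powr r"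
    by (rule Youngs_inequality_0) (use assms t in auto)
  also have "(t powr r) powr (1 / r) * (a powr r) powr (1 - 1 / r) = t * a powr (r - 1)"
    using assms t by (simp add: powr_powr right_diff_distrib)
  finally have "t * a powr (r - 1) * r \<le> (1 / r * t powr r + (1 - 1 / r) * a powr r) * r"
    using assms by (intro mult_right_mono) auto
  also have "\<dots> = t powr r + (r - 1) * a powr r"
    using assms by (simp add: field_simps)
  finally have "t * a powr (r - 1) * r \<le> t powr r + (r - 1) * a powr r" .
  moreover have "a powr r = a powr (r - 1) * a"
    using assms by (simp add: powr_mult_base mult.commute)
  ultimately show ?thesis
    by (simp add: algebra_simps)
qed

text \<open>The tangent is taken at the larger point \<open>A + a\<close> and evaluated at
  \<open>A\<close>. The increment \<open>a\<close> is therefore multiplied by a power of the full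
  sum, which is why the tails below contain their own first term.\<close>

lemma powr_add_le_telescope:
  fixes A a r :: real
  assumes "0 \<le> A" "0 \<le> a" "1 \<le> r"
  shows "(A + a) powr r \<le> A powr r + r * a * (A + a) powr (r - 1)"
proof (cases "A + a = 0")
  case False
  then show ?thesis
    using powr_above_tangent[of A "A + a" r] assms by (simp add: algebra_simps)
qed (use assms in auto)

text \<open>Terms are added in decreasing order of \<open>D\<close>, so when \<open>i\<close>
  enters, the partial sum runs over indices \<open>j\<close> with \<open>D i \<le> D j\<close>. This
  is the discrete form of writing F^r as the integral of r F^(r-1) dF.\<close>

lemma sum_powr_le_tails:
  fixes a D :: "'i \<Rightarrow> real"
  assumes "finite V" "\<And>i. i \<in> V \<Longrightarrow> 0 \<le> a i" "1 \<le> r"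
  shows "(\<Sum>i\<in>V. a i) powr r \<le> r * (\<Sum>i\<in>V. a i * (\<Sum>j\<in>{j\<in>V. D i \<le> D j}. a j) powr (r - 1))"
  using assms
proof (induction V rule: finite_ranking_induct[where f = "\<lambda>i. - D i"])
  case (insert x S)
  let ?T = "\<lambda>V i. (\<Sum>j\<in>{j\<in>V. D i \<le> D j}. a j)"
  have Dx: "D x \<le> D y" if "y \<in> S" for y
    using insert(2)[OF that] by simp
  show ?case
  proof (cases "x \<in> S")
    case True
    then show ?thesis using insert by (simp add: insert_absorb)
  next
    case False
    have all: "{j \<in> insert x S. D x \<le> D j} = insert x S"
      using Dx by auto
    have nn: "0 \<le> (\<Sum>i\<in>S. a i)"
      using insert by (intro sum_nonneg) auto
    have "(\<Sum>i\<in>insert x S. a i) powr r = ((\<Sum>i\<in>S. a i) + a x) powr r"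
      using False insert by (simp add: add.commute)
    also have "\<dots> \<le> (\<Sum>i\<in>S. a i) powr r + r * a x * ((\<Sum>i\<in>S. a i) + a x) powr (r - 1)"
      by (rule powr_add_le_telescope) (use nn insert in auto)
    also have "(\<Sum>i\<in>S. a i) powr r \<le> r * (\<Sum>i\<in>S. a i * ?T S i powr (r - 1))"
      using insert by auto
    \<comment> \<open>A new index with the same value of \<open>D\<close> joins the old tails, so
      these are bounded from above rather than preserved.\<close>
    also have "\<dots> \<le> r * (\<Sum>i\<in>S. a i * ?T (insert x S) i powr (r - 1))"
    proof (intro mult_left_mono sum_mono powr_mono2)
      show "?T S i \<le> ?T (insert x S) i" if "i \<in> S" for i
        using insert by (intro sum_mono2) auto
    qed (use insert in \<open>auto intro!: sum_nonneg\<close>)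
    also have "r * a x * ((\<Sum>i\<in>S. a i) + a x) powr (r - 1) = r * (a x * ?T (insert x S) x powr (r - 1))"
      unfolding all using False insert by (simp add: algebra_simps)
    finally show ?thesis
      using False insert by (simp add: algebra_simps)
  qed
qed auto

text \<open>Young's inequality with the coefficient 1/2 on \<open>t powr r\<close>, the form that
  absorption needs. Either \<open>M * h\<close> is at most \<open>t / 2\<close> or \<open>t\<close>
  is below \<open>2 * M * h\<close>; in each case a single term on the right suffices.\<close>

lemma young_absorb:
  fixes M h t r :: real
  assumes "0 \<le> M" "0 \<le> h" "0 \<le> t" "1 \<le> r"
  shows "M * h * t powr (r - 1) \<le> t powr r / 2 + (2 * M) powr r * h powr r / 2"
proof (cases "M * h \<le> t / 2")
  case True
  have "M * h * t powr (r - 1) \<le> t / 2 * t powr (r - 1)"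
    using True by (intro mult_right_mono) auto
  also have "\<dots> = t powr r / 2"
    using assms by (simp add: powr_mult_base)
  finally show ?thesis
    by (rule order_trans) simp
next
  case False
  have "M * h * t powr (r - 1) \<le> M * h * (2 * M * h) powr (r - 1)"
    using False assms by (intro mult_left_mono powr_mono2) auto
  also have "\<dots> = (2 * M * h) * (2 * M * h) powr (r - 1) / 2"
    by simp
  also have "\<dots> = (2 * M * h) powr r / 2"
    using assms by (subst powr_mult_base) auto
  also have "\<dots> = (2 * M) powr r * h powr r / 2"
    using assms by (simp add: powr_mult)
  finally show ?thesis
    by (rule order_trans) simp
qed

text \<open>Expanding the power along the order given by \<open>D Q\<close> turns the inner sum at \<open>Q\<close>
  into the tail over the indices farther from \<open>Q\<close> than \<open>S\<close>; that tail is controlled by the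
  operator evaluated at \<open>S\<close>. This replaces duality and the maximal function.\<close>

lemma sum_operator_powr_bound:
  fixes k D :: "'i \<Rightarrow> 'i \<Rightarrow> real" and m h :: "'i \<Rightarrow> real" and A B r :: real
  assumes V: "finite V" and r: "1 \<le> r" and A: "0 \<le> A" and B: "0 \<le> B"
    and m: "\<And>Q. Q \<in> V \<Longrightarrow> 0 \<le> m Q" and h: "\<And>Q. Q \<in> V \<Longrightarrow> 0 \<le> h Q"
    and k: "\<And>Q S. Q \<in> V \<Longrightarrow> S \<in> V \<Longrightarrow> 0 \<le> k Q S"
    and col: "\<And>S. S \<in> V \<Longrightarrow> (\<Sum>Q\<in>V. m Q * k Q S) \<le> A * m S"
    and tail: "\<And>Q S Z. Q \<in> V \<Longrightarrow> S \<in> V \<Longrightarrow> Z \<in> V \<Longrightarrow> D Q S \<le> D Q Z \<Longrightarrow> k Q Z \<le> B * k S Z"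
  shows "(\<Sum>Q\<in>V. m Q * (\<Sum>S\<in>V. k Q S * h S) powr r)
       \<le> (2 * (r * B powr (r - 1) * A)) powr r * (\<Sum>Q\<in>V. m Q * h Q powr r)"
proof -
  define T where "T = (\<lambda>Q. \<Sum>S\<in>V. k Q S * h S)"
  define M where "M = r * B powr (r - 1) * A"
  have M0: "0 \<le> M" using r A by (simp add: M_def)
  have T0: "0 \<le> T Q" if "Q \<in> V" for Q
    unfolding T_def using k h that by (intro sum_nonneg mult_nonneg_nonneg) auto
  have "(\<Sum>Q\<in>V. m Q * T Q powr r)
      \<le> (\<Sum>Q\<in>V. m Q * (r * (\<Sum>S\<in>V. k Q S * h S * (B powr (r - 1) * T S powr (r - 1)))))"
  proof (intro sum_mono mult_left_mono m)
    fix Q assume Q: "Q \<in> V"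
    have "T Q powr r \<le> r * (\<Sum>S\<in>V. k Q S * h S * (\<Sum>Z\<in>{Z\<in>V. D Q S \<le> D Q Z}. k Q Z * h Z) powr (r - 1))"
      unfolding T_def by (rule sum_powr_le_tails) (use V r k h Q in auto)
    also have "\<dots> \<le> r * (\<Sum>S\<in>V. k Q S * h S * (B * T S) powr (r - 1))"
    proof (intro mult_left_mono sum_mono powr_mono2)
      fix S assume S: "S \<in> V"
      have "(\<Sum>Z\<in>{Z\<in>V. D Q S \<le> D Q Z}. k Q Z * h Z) \<le> (\<Sum>Z\<in>{Z\<in>V. D Q S \<le> D Q Z}. B * k S Z * h Z)"
        using tail[OF Q S] h by (intro sum_mono mult_right_mono) auto
      also have "\<dots> \<le> (\<Sum>Z\<in>V. B * k S Z * h Z)"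
        using V B k S h by (intro sum_mono2 mult_nonneg_nonneg) auto
      also have "\<dots> = B * T S"
        by (simp add: T_def sum_distrib_left mult.assoc)
      finally show "(\<Sum>Z\<in>{Z\<in>V. D Q S \<le> D Q Z}. k Q Z * h Z) \<le> B * T S" .
      show "0 \<le> (\<Sum>Z\<in>{Z\<in>V. D Q S \<le> D Q Z}. k Q Z * h Z)"
        using k h Q by (intro sum_nonneg mult_nonneg_nonneg) auto
      show "0 \<le> k Q S * h S" using k h Q S by simp
    qed (use r in auto)
    also have "\<dots> = r * (\<Sum>S\<in>V. k Q S * h S * (B powr (r - 1) * T S powr (r - 1)))"
      using B T0 by (simp add: powr_mult)
    finally show "T Q powr r \<le> r * (\<Sum>S\<in>V. k Q S * h S * (B powr (r - 1) * T S powr (r - 1)))" .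
  qed
  \<comment> \<open>After the swap the inner sum over \<open>Q\<close> is a column sum of the kernel
    against \<open>m\<close>, to which \<open>col\<close> applies.\<close>
  also have "\<dots> = (\<Sum>S\<in>V. r * B powr (r - 1) * h S * T S powr (r - 1) * (\<Sum>Q\<in>V. m Q * k Q S))"
    by (simp only: sum_distrib_left, subst sum.swap) (simp add: mult_ac)
  also have "\<dots> \<le> (\<Sum>S\<in>V. r * B powr (r - 1) * h S * T S powr (r - 1) * (A * m S))"
    using col r h by (intro sum_mono mult_left_mono mult_nonneg_nonneg) auto
  also have "\<dots> = (\<Sum>S\<in>V. m S * (M * h S * T S powr (r - 1)))"
    by (simp add: M_def mult_ac)
  \<comment> \<open>Half of the left-hand side reappears here. Being a finite real number it can be
    subtracted, and the other factor 1/2 then cancels.\<close>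
  also have "\<dots> \<le> (\<Sum>S\<in>V. m S * (T S powr r / 2 + (2 * M) powr r * h S powr r / 2))"
    using m h T0 M0 r by (intro sum_mono mult_left_mono young_absorb) auto
  also have "\<dots> = (\<Sum>S\<in>V. m S * T S powr r) / 2 + (2 * M) powr r * (\<Sum>S\<in>V. m S * h S powr r) / 2"
    by (simp add: sum_distrib_left sum.distrib sum_divide_distrib algebra_simps)
  finally show ?thesis
    by (simp add: T_def M_def)
qed

text \<open>Jensen's inequality with unnormalised weights: when the tangent lines at the weighted
  mean \<open>U / w0\<close> are summed, the linear terms cancel. The power of the total weight is
  what later changes the exponent of the kernel.\<close>

lemma powr_weighted_sum_le:
  fixes w u :: "'i \<Rightarrow> real"
  assumes "finite V" "\<And>i. i \<in> V \<Longrightarrow> 0 \<le> w i" "\<And>i. i \<in> V \<Longrightarrow> 0 \<le> u i" "1 \<le> q"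
  shows "(\<Sum>i\<in>V. w i * u i) powr q \<le> (\<Sum>i\<in>V. w i) powr (q - 1) * (\<Sum>i\<in>V. w i * u i powr q)"
proof -
  define U where "U = (\<Sum>i\<in>V. w i * u i)"
  define w0 where "w0 = (\<Sum>i\<in>V. w i)"
  have U0: "0 \<le> U" unfolding U_def using assms by (intro sum_nonneg) auto
  have w00: "0 \<le> w0" unfolding w0_def using assms by (intro sum_nonneg) auto
  show ?thesis
  proof (cases "U = 0")
    case True
    then show ?thesis using assms unfolding U_def
      by (auto intro!: mult_nonneg_nonneg sum_nonneg)
  next
    case False
    then have Up: "U > 0" using U0 by simp
    have wp: "w0 > 0"
    proof (rule ccontr)
      assume "\<not> w0 > 0"
      then have "w0 = 0" using w00 by simp
      then have "\<forall>i\<in>V. w i = 0"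
        unfolding w0_def using assms by (subst (asm) sum_nonneg_eq_0_iff) auto
      then show False using False by (simp add: U_def)
    qed
    define a where "a = U / w0"
    have a: "a > 0" using Up wp by (simp add: a_def)
    have "w0 * a powr q + q * a powr (q - 1) * (U - w0 * a)
        = (\<Sum>i\<in>V. w i * (a powr q + q * a powr (q - 1) * (u i - a)))"
      unfolding w0_def U_def
      by (simp add: algebra_simps sum.distrib sum_subtractf sum_distrib_left sum_distrib_right)
    also have "\<dots> \<le> (\<Sum>i\<in>V. w i * u i powr q)"
      using assms a by (intro sum_mono mult_left_mono powr_above_tangent) auto
    finally have "w0 * a powr q \<le> (\<Sum>i\<in>V. w i * u i powr q)"
      using wp by (simp add: a_def)
    then have "w0 powr (q - 1) * (w0 * a powr q) \<le> w0 powr (q - 1) * (\<Sum>i\<in>V. w i * u i powr q)"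
      by (intro mult_left_mono) auto
    also have "w0 powr (q - 1) * (w0 * a powr q) = U powr q"
      using wp Up by (simp add: a_def powr_divide powr_diff)
    finally show ?thesis by (simp add: U_def w0_def)
  qed
qed

section \<open>Geometric sums over dyadic shells\<close>

lemma sum_filter_le_add:
  fixes f :: "'i \<Rightarrow> real"
  assumes "finite V" "\<And>i. i \<in> V \<Longrightarrow> 0 \<le> f i" "\<And>i. i \<in> V \<Longrightarrow> P i \<Longrightarrow> Q i \<or> R i"
  shows "sum f {i\<in>V. P i} \<le> sum f {i\<in>V. Q i} + sum f {i\<in>V. R i}"
proof -
  have "(\<Sum>i\<in>V. if P i then f i else 0) \<le> (\<Sum>i\<in>V. (if Q i then f i else 0) + (if R i then f i else 0))"
    using assms(2,3) by (intro sum_mono) auto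
  then show ?thesis
    using assms(1) by (simp add: sum.inter_filter sum.distrib)
qed

text \<open>Discrete counterpart of integrating |y|^(-\<sigma> - d) outside a ball of radius
  \<open>R\<close>, with the growth bound \<open>vol\<close> in the role of Lebesgue measure. The
  shell from R to 2R is split off, and the rest is handled by induction on the number of doublings
  that exceed every \<open>D i\<close>.\<close>

lemma sum_far_le:
  fixes m D :: "'i \<Rightarrow> real" and A d \<sigma> R :: real
  assumes V: "finite V" and m: "\<And>i. i \<in> V \<Longrightarrow> 0 \<le> m i"
    and vol: "\<And>\<rho>. 0 < \<rho> \<Longrightarrow> (\<Sum>i\<in>{i\<in>V. D i \<le> \<rho>}. m i) \<le> A * \<rho> powr d"
    and A: "0 \<le> A" and \<sigma>: "0 < \<sigma>" and d: "0 \<le> d" and R: "0 < R"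
  shows "(\<Sum>i\<in>{i\<in>V. R \<le> D i}. m i * D i powr (- \<sigma> - d)) \<le> A * 2 powr d / (1 - 2 powr - \<sigma>) * R powr - \<sigma>"
proof -
  define C where "C = A * 2 powr d / (1 - 2 powr - \<sigma>)"
  have s2: "2 powr - \<sigma> < 1" using \<sigma> by (simp add: powr_less_one)
  have C0: "0 \<le> C" unfolding C_def using s2 A by simp
  \<comment> \<open>\<open>C\<close> is the sum of a geometric series, but it enters only through
    this fixed point equation, which is what one induction step requires.\<close>
  have CC: "A * 2 powr d + C * 2 powr - \<sigma> = C"
  proof -
    have "C * (1 - 2 powr - \<sigma>) = A * 2 powr d" using s2 \<sigma> by (simp add: C_def)
    then show ?thesis by (simp add: algebra_simps)
  qed
  obtain n :: nat where n: "\<forall>i\<in>V. D i < 2 ^ n * R"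
  proof -
    obtain M where M: "\<forall>i\<in>V. D i \<le> M"
      using V by (meson bdd_above_def bdd_above_finite finite_imageI image_eqI)
    obtain n :: nat where "M / R < 2 ^ n" using real_arch_pow[of 2 "M / R"] by auto
    then have "M < 2 ^ n * R" using R by (simp add: field_simps)
    then have "\<forall>i\<in>V. D i < 2 ^ n * R" using M by force
    then show ?thesis by (rule that)
  qed
  have "(\<Sum>i\<in>{i\<in>V. R \<le> D i}. m i * D i powr (- \<sigma> - d)) \<le> C * R powr - \<sigma>"
    using R n
  proof (induction n arbitrary: R)
    case 0
    then have e: "{i\<in>V. R \<le> D i} = {}" by force
    show ?case unfolding e using C0 by simp
  next
    case (Suc n)
    have "(\<Sum>i\<in>{i\<in>V. R \<le> D i}. m i * D i powr (- \<sigma> - d))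
        \<le> (\<Sum>i\<in>{i\<in>V. R \<le> D i \<and> D i \<le> 2 * R}. m i * D i powr (- \<sigma> - d))
          + (\<Sum>i\<in>{i\<in>V. 2 * R \<le> D i}. m i * D i powr (- \<sigma> - d))"
      using V m by (intro sum_filter_le_add) auto
    also have "(\<Sum>i\<in>{i\<in>V. R \<le> D i \<and> D i \<le> 2 * R}. m i * D i powr (- \<sigma> - d))
        \<le> (\<Sum>i\<in>{i\<in>V. R \<le> D i \<and> D i \<le> 2 * R}. m i * R powr (- \<sigma> - d))"
      using m Suc.prems \<sigma> d by (intro sum_mono mult_left_mono powr_mono2') auto
    also have "\<dots> \<le> (\<Sum>i\<in>{i\<in>V. D i \<le> 2 * R}. m i) * R powr (- \<sigma> - d)"
      unfolding sum_distrib_right[symmetric] using V m by (intro mult_right_mono sum_mono2) auto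
    also have "\<dots> \<le> A * (2 * R) powr d * R powr (- \<sigma> - d)"
      using Suc.prems by (intro mult_right_mono vol) auto
    also have "\<dots> = A * 2 powr d * R powr - \<sigma>"
    proof -
      have "R powr d * R powr (- \<sigma> - d) = R powr - \<sigma>"
        by (simp flip: powr_add)
      then show ?thesis
        using Suc.prems by (simp add: powr_mult mult.assoc)
    qed
    also have "(\<Sum>i\<in>{i\<in>V. 2 * R \<le> D i}. m i * D i powr (- \<sigma> - d)) \<le> C * (2 * R) powr - \<sigma>"
      using Suc.prems by (intro Suc.IH) (auto simp: mult_ac)
    also have "A * 2 powr d * R powr - \<sigma> + C * (2 * R) powr - \<sigma> = (A * 2 powr d + C * 2 powr - \<sigma>) * R powr - \<sigma>"
      using Suc.prems by (simp add: powr_mult distrib_right mult.assoc)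
    finally show ?case unfolding CC by simp
  qed
  then show ?thesis by (simp add: C_def)
qed

text \<open>Counterpart of integrating |y|^(\<sigma> - d) over a ball of radius \<open>R\<close>.
  The radius is halved instead of doubled; positivity of the finitely many \<open>D i\<close> makes
  the induction stop.\<close>

lemma sum_near_le:
  fixes m D :: "'i \<Rightarrow> real" and A d \<sigma> R :: real
  assumes V: "finite V" and m: "\<And>i. i \<in> V \<Longrightarrow> 0 \<le> m i" and D: "\<And>i. i \<in> V \<Longrightarrow> 0 < D i"
    and vol: "\<And>\<rho>. 0 < \<rho> \<Longrightarrow> (\<Sum>i\<in>{i\<in>V. D i \<le> \<rho>}. m i) \<le> A * \<rho> powr d"
    and A: "0 \<le> A" and \<sigma>: "0 < \<sigma>" and d: "0 \<le> d" and R: "0 < R"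
  shows "(\<Sum>i\<in>{i\<in>V. D i \<le> R}. m i * D i powr (\<sigma> - d)) \<le> A * 2 powr d / (1 - 2 powr - \<sigma>) * R powr \<sigma>"
proof -
  define C where "C = A * 2 powr d / (1 - 2 powr - \<sigma>)"
  have s2: "2 powr - \<sigma> < 1" using \<sigma> by (simp add: powr_less_one)
  have C0: "0 \<le> C" unfolding C_def using s2 A by simp
  have CC: "A * 2 powr d + C * 2 powr - \<sigma> = C"
  proof -
    have "C * (1 - 2 powr - \<sigma>) = A * 2 powr d" using s2 \<sigma> by (simp add: C_def)
    then show ?thesis by (simp add: algebra_simps)
  qed
  obtain n :: nat where n: "\<forall>i\<in>V. R < 2 ^ n * D i"
  proof -
    have "\<exists>M. \<forall>i\<in>V. R / D i \<le> M"
      using V by (meson bdd_above_def bdd_above_finite finite_imageI image_eqI)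
    then obtain M where M: "\<forall>i\<in>V. R / D i \<le> M" by blast
    obtain n :: nat where "M < 2 ^ n" using real_arch_pow[of 2 "M"] by auto
    then have "\<forall>i\<in>V. R / D i < 2 ^ n" using M by fastforce
    then show ?thesis using D that by (auto simp: field_simps)
  qed
  have "(\<Sum>i\<in>{i\<in>V. D i \<le> R}. m i * D i powr (\<sigma> - d)) \<le> C * R powr \<sigma>"
    using R n
  proof (induction n arbitrary: R)
    case 0
    then have e: "{i\<in>V. D i \<le> R} = {}" by force
    show ?case unfolding e using C0 by simp
  next
    case (Suc n)
    have "(\<Sum>i\<in>{i\<in>V. D i \<le> R}. m i * D i powr (\<sigma> - d))
        \<le> (\<Sum>i\<in>{i\<in>V. R / 2 \<le> D i \<and> D i \<le> R}. m i * D i powr (\<sigma> - d))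
          + (\<Sum>i\<in>{i\<in>V. D i \<le> R / 2}. m i * D i powr (\<sigma> - d))"
      using V m by (intro sum_filter_le_add) auto
    also have "(\<Sum>i\<in>{i\<in>V. R / 2 \<le> D i \<and> D i \<le> R}. m i * D i powr (\<sigma> - d))
        \<le> (\<Sum>i\<in>{i\<in>V. R / 2 \<le> D i \<and> D i \<le> R}. m i * (R powr \<sigma> * (R / 2) powr - d))"
    proof (intro sum_mono mult_left_mono)
      fix i assume "i \<in> {i\<in>V. R / 2 \<le> D i \<and> D i \<le> R}"
      then have i: "i \<in> V" "R / 2 \<le> D i" "D i \<le> R" by auto
      \<comment> \<open>The sign of \<sigma> - d is unknown, so the two factors are bounded
        separately, at opposite ends of the shell.\<close>
      have "D i powr (\<sigma> - d) = D i powr \<sigma> * D i powr - d"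
        by (simp add: powr_diff powr_minus divide_inverse)
      also have "\<dots> \<le> R powr \<sigma> * (R / 2) powr - d"
        using i Suc.prems \<sigma> d by (intro mult_mono powr_mono2 powr_mono2') auto
      finally show "D i powr (\<sigma> - d) \<le> R powr \<sigma> * (R / 2) powr - d" .
    qed (use m in auto)
    also have "\<dots> \<le> (\<Sum>i\<in>{i\<in>V. D i \<le> R}. m i) * (R powr \<sigma> * (R / 2) powr - d)"
      unfolding sum_distrib_right[symmetric] using V m by (intro mult_right_mono sum_mono2) auto
    also have "\<dots> \<le> A * R powr d * (R powr \<sigma> * (R / 2) powr - d)"
      using Suc.prems by (intro mult_right_mono vol) auto
    also have "\<dots> = A * 2 powr d * R powr \<sigma>"
    proof -
      have "(R / 2) powr - d = 2 powr d * R powr - d"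
        using Suc.prems by (simp add: powr_divide powr_minus_divide)
      moreover have "R powr d * R powr - d = 1"
        using Suc.prems by (simp flip: powr_add)
      ultimately show ?thesis
        by (simp add: mult_ac)
    qed
    also have "(\<Sum>i\<in>{i\<in>V. D i \<le> R / 2}. m i * D i powr (\<sigma> - d)) \<le> C * (R / 2) powr \<sigma>"
      using Suc.prems by (intro Suc.IH) (auto simp: mult_ac)
    also have "A * 2 powr d * R powr \<sigma> + C * (R / 2) powr \<sigma> = (A * 2 powr d + C * 2 powr - \<sigma>) * R powr \<sigma>"
    proof -
      have "(R / 2) powr \<sigma> = 2 powr - \<sigma> * R powr \<sigma>"
        using Suc.prems by (simp add: powr_divide powr_minus_divide)
      then show ?thesis by (simp add: distrib_right mult.assoc)
    qed
    finally show ?case unfolding CC by simp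
  qed
  then show ?thesis by (simp add: C_def)
qed

subsection \<open>Geometry of cubes and chains\<close>

text \<open>Comparable to \<open>Dcubes\<close> by dimensional constants, but with a genuine triangle inequality.\<close>

definition cube_gap :: "'a::euclidean_space \<times> real \<Rightarrow> 'a \<times> real \<Rightarrow> real" where
  "cube_gap Q S = side Q + side S + dist (fst Q) (fst S)"

lemma cube_gap_commute: "cube_gap Q S = cube_gap S Q"
  by (simp add: cube_gap_def dist_commute)

lemma cube_gap_triangle:
  assumes "0 \<le> side P"
  shows "cube_gap Q S \<le> cube_gap Q P + cube_gap P S"
  using assms dist_triangle[of "fst Q" "fst S" "fst P"] by (simp add: cube_gap_def)

lemma side_le_cube_gap:
  assumes "0 \<le> side Q" "0 \<le> side S"
  shows "side Q \<le> cube_gap Q S" "side S \<le> cube_gap Q S"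
  using assms by (simp_all add: cube_gap_def)

lemma cube_gap_pos:
  assumes "0 < side Q" "0 < side S"
  shows "0 < cube_gap Q S"
  using assms by (simp add: cube_gap_def add_pos_nonneg)

lemma norm_le_DIM_mult:
  fixes x :: "'a::euclidean_space"
  assumes "\<And>i. i \<in> Basis \<Longrightarrow> \<bar>x \<bullet> i\<bar> \<le> c"
  shows "norm x \<le> real DIM('a) * c"
proof -
  have "norm x \<le> (\<Sum>i\<in>Basis. \<bar>x \<bullet> i\<bar>)"
    by (rule norm_le_l1)
  also have "\<dots> \<le> real DIM('a) * c"
    using assms by (intro sum_bounded_above) auto
  finally show ?thesis .
qed

section \<open>Cubes as boxes: topology and volume\<close>

lemma ocube_eq_box: "ocube Q = box (fst Q - (snd Q / 2) *\<^sub>R One) (fst Q + (snd Q / 2) *\<^sub>R One)"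
proof -
  have "\<bar>x \<bullet> i - fst Q \<bullet> i\<bar> < snd Q / 2 \<longleftrightarrow>
      (fst Q - (snd Q / 2) *\<^sub>R One) \<bullet> i < x \<bullet> i \<and> x \<bullet> i < (fst Q + (snd Q / 2) *\<^sub>R One) \<bullet> i"
    if "i \<in> Basis" for i x
    using that by (simp add: inner_diff_left inner_add_left) (auto simp: abs_if)
  then show ?thesis
    by (auto simp: ocube_def mem_box)
qed

lemma ccube_eq_cbox: "ccube Q = cbox (fst Q - (snd Q / 2) *\<^sub>R One) (fst Q + (snd Q / 2) *\<^sub>R One)"
proof -
  have "\<bar>x \<bullet> i - fst Q \<bullet> i\<bar> \<le> snd Q / 2 \<longleftrightarrow>
      (fst Q - (snd Q / 2) *\<^sub>R One) \<bullet> i \<le> x \<bullet> i \<and> x \<bullet> i \<le> (fst Q + (snd Q / 2) *\<^sub>R One) \<bullet> i"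
    if "i \<in> Basis" for i x
    using that by (simp add: inner_diff_left inner_add_left) (auto simp: abs_if)
  then show ?thesis
    by (auto simp: ccube_def mem_box)
qed

lemma mem_ocube_imp_ccube: "x \<in> ocube Q \<Longrightarrow> x \<in> ccube Q"
  by (auto simp: ocube_def ccube_def less_imp_le)

lemma ocube_subset_dil:
  assumes "0 \<le> side Q" shows "ocube Q \<subseteq> ocube (dil 5 Q)"
proof
  fix x assume x: "x \<in> ocube Q"
  have "\<bar>x \<bullet> i - fst Q \<bullet> i\<bar> < 5 * snd Q / 2" if "i \<in> Basis" for i
  proof -
    have "\<bar>x \<bullet> i - fst Q \<bullet> i\<bar> < snd Q / 2" using x that by (simp add: ocube_def)
    then show ?thesis using assms by (simp add: side_def)
  qed
  then show "x \<in> ocube (dil 5 Q)" by (simp add: ocube_def dil_def)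
qed

lemma open_ocube [simp]: "open (ocube Q)"
  by (simp add: ocube_eq_box open_box)

lemma compact_ccube: "compact (ccube Q)"
  by (simp add: ccube_eq_cbox compact_cbox)

lemma ocube_sets_borel [measurable, simp]: "ocube Q \<in> sets borel"
  by (simp add: ocube_eq_box)

lemma ocube_sets_lebesgue [measurable, simp]: "ocube Q \<in> sets lebesgue"
  by (simp add: ocube_eq_box)

lemma center_in_ocube: "0 < side Q \<Longrightarrow> fst Q \<in> ocube Q"
  by (simp add: ocube_def side_def)

lemma emeasure_ocube:
  fixes Q :: "'a::euclidean_space \<times> real"
  assumes "0 < side Q"
  shows "emeasure lebesgue (ocube Q) = ennreal (side Q powr real DIM('a))"
  using assms unfolding ocube_eq_box
  by (simp add: emeasure_lborel_box_eq side_def inner_diff_left inner_add_left powr_realpow)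

lemma emeasure_ccube:
  fixes Q :: "'a::euclidean_space \<times> real"
  assumes "0 < side Q"
  shows "emeasure lebesgue (ccube Q) = ennreal (side Q powr real DIM('a))"
  using assms unfolding ccube_eq_cbox
  by (simp add: emeasure_lborel_cbox_eq side_def inner_diff_left inner_add_left powr_realpow)

lemma dist_le_of_mem_ccube:
  fixes Q :: "'a::euclidean_space \<times> real"
  assumes "x \<in> ccube Q"
  shows "dist (fst Q) x \<le> real DIM('a) * (side Q / 2)"
  unfolding dist_norm
  by (rule norm_le_DIM_mult) (use assms in \<open>simp add: ccube_def side_def inner_diff_left abs_minus_commute\<close>)

definition disjoint_cubes :: "('a::euclidean_space \<times> real) set \<Rightarrow> bool" where
  "disjoint_cubes V \<longleftrightarrow> finite V \<and> (\<forall>S\<in>V. 0 < side S) \<and>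
     (\<forall>S\<in>V. \<forall>P\<in>V. S \<noteq> P \<longrightarrow> ocube S \<inter> ocube P = {})"

text \<open>The gap contains the side of \<open>S\<close>, so each cube counted lies wholly in the
  cube of side 2\<rho> around the centre of \<open>Q\<close>; disjointness lets the volumes add up.
  This is the growth bound that feeds the geometric sums.\<close>

lemma sum_volume_near_cube:
  fixes Q :: "'a::euclidean_space \<times> real"
  assumes dc: "disjoint_cubes V" and Q: "0 < side Q" and \<rho>: "0 < \<rho>"
  shows "(\<Sum>S\<in>{S\<in>V. cube_gap Q S \<le> \<rho>}. side S powr real DIM('a)) \<le> 2 powr real DIM('a) * \<rho> powr real DIM('a)"
proof -
  have V: "finite V" and pos: "\<And>S. S \<in> V \<Longrightarrow> 0 < side S"
    and disj: "\<And>S P. S \<in> V \<Longrightarrow> P \<in> V \<Longrightarrow> S \<noteq> P \<Longrightarrow> ocube S \<inter> ocube P = {}"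
    using dc unfolding disjoint_cubes_def by blast+
  let ?U = "{S\<in>V. cube_gap Q S \<le> \<rho>}"
  have sub: "(\<Union>S\<in>?U. ocube S) \<subseteq> ccube (fst Q, 2 * \<rho>)"
  proof clarify
    fix S x assume S: "S \<in> V" "cube_gap Q S \<le> \<rho>" and x: "x \<in> ocube S"
    have "\<bar>x \<bullet> i - fst Q \<bullet> i\<bar> \<le> \<rho>" if i: "i \<in> Basis" for i
    proof -
      have "\<bar>(fst S - fst Q) \<bullet> i\<bar> \<le> dist (fst Q) (fst S)"
        using Basis_le_norm[OF i, of "fst S - fst Q"] by (simp add: dist_norm norm_minus_commute)
      moreover have "\<bar>x \<bullet> i - fst S \<bullet> i\<bar> < side S / 2"
        using x i by (simp add: ocube_def side_def)
      ultimately show ?thesis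
        using S Q pos[OF S(1)] unfolding cube_gap_def inner_diff_left by linarith
    qed
    then show "x \<in> ccube (fst Q, 2 * \<rho>)" by (simp add: ccube_def)
  qed
  have "ennreal (\<Sum>S\<in>?U. side S powr real DIM('a)) = (\<Sum>S\<in>?U. emeasure lebesgue (ocube S))"
    using pos by (subst sum_ennreal[symmetric]) (auto simp: emeasure_ocube intro!: sum.cong simp del: emeasure_completion)
  also have "\<dots> = emeasure lebesgue (\<Union>S\<in>?U. ocube S)"
    using V disj by (intro sum_emeasure) (auto simp: disjoint_family_on_def)
  also have "\<dots> \<le> emeasure lebesgue (ccube (fst Q, 2 * \<rho>))"
    using sub by (intro emeasure_mono) (auto simp: ccube_eq_cbox)
  also have "\<dots> = ennreal ((2 * \<rho>) powr real DIM('a))"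
    using \<rho> by (subst emeasure_ccube) (auto simp: side_def)
  finally show ?thesis
    using \<rho> by (simp add: powr_mult)
qed

lemma Dcubes_le_cube_gap:
  assumes "0 < side Q" "0 < side S"
  shows "Dcubes Q S \<le> cube_gap Q S"
  using setdist_le_dist[OF center_in_ocube[OF assms(1)] center_in_ocube[OF assms(2)]]
  by (simp add: Dcubes_def cube_gap_def)

text \<open>Every point of a cube is within d/2 sides of its centre, so the distance of the centres
  exceeds the distance of the cubes by at most d/2 times the sum of the sides.\<close>

lemma cube_gap_le_Dcubes:
  fixes Q S :: "'a::euclidean_space \<times> real"
  assumes "0 < side Q" "0 < side S"
  shows "cube_gap Q S \<le> (real DIM('a) + 1) * Dcubes Q S"
proof -
  let ?d = "real DIM('a)"
  have "dist (fst Q) (fst S) - ?d * (side Q / 2) - ?d * (side S / 2) \<le> setdist (ocube Q) (ocube S)"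
  proof (rule le_setdistI)
    show "ocube Q \<noteq> {}" "ocube S \<noteq> {}"
      using center_in_ocube[OF assms(1)] center_in_ocube[OF assms(2)] by auto
    fix x y assume "x \<in> ocube Q" "y \<in> ocube S"
    then have "x \<in> ccube Q" "y \<in> ccube S" by (simp_all add: mem_ocube_imp_ccube)
    from this[THEN dist_le_of_mem_ccube]
    show "dist (fst Q) (fst S) - ?d * (side Q / 2) - ?d * (side S / 2) \<le> dist x y"
      using dist_triangle[of "fst Q" "fst S" x] dist_triangle[of x "fst S" y]
      by (simp add: dist_commute)
  qed
  moreover have "0 \<le> ?d * side Q" "0 \<le> ?d * side S" "0 \<le> ?d * setdist (ocube Q) (ocube S)"
    using assms by (simp_all add: setdist_pos_le)
  ultimately show ?thesis
    unfolding cube_gap_def Dcubes_def distrib_left distrib_right by linarith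
qed

section \<open>Neighbors and chains\<close>

lemma neighbors_dist_le:
  fixes Q S :: "'a::euclidean_space \<times> real"
  assumes "neighbors Q S"
  shows "dist (fst Q) (fst S) \<le> real DIM('a) * (side Q / 2) + real DIM('a) * (side S / 2)"
proof -
  obtain z where "z \<in> ccube Q" "z \<in> ccube S" using assms by (auto simp: neighbors_def)
  from this[THEN dist_le_of_mem_ccube] show ?thesis
    using dist_triangle[of "fst Q" "fst S" z] by (simp add: dist_commute)
qed

lemma neighbors_commute: "neighbors Q S = neighbors S Q"
  by (auto simp: neighbors_def)

lemma neighbor_subset_dil:
  assumes "neighbors Q S" "side S \<le> side Q" "0 < side Q"
  shows "ocube S \<subseteq> ocube (dil 5 Q)"
proof
  fix y assume y: "y \<in> ocube S"
  obtain z where z: "z \<in> ccube Q" "z \<in> ccube S" using assms by (auto simp: neighbors_def)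
  have "\<bar>y \<bullet> i - fst Q \<bullet> i\<bar> < 5 * side Q / 2" if i: "i \<in> Basis" for i
  proof -
    have "\<bar>y \<bullet> i - fst S \<bullet> i\<bar> < side S / 2" "\<bar>z \<bullet> i - fst S \<bullet> i\<bar> \<le> side S / 2"
      "\<bar>z \<bullet> i - fst Q \<bullet> i\<bar> \<le> side Q / 2"
      using y z i by (auto simp: ocube_def ccube_def side_def)
    then show ?thesis using assms by linarith
  qed
  then show "y \<in> ocube (dil 5 Q)" by (simp add: ocube_def dil_def side_def)
qed

lemma dist_in_chain_le:
  fixes ch :: "('a::euclidean_space \<times> real) list"
  assumes nb: "\<And>k. Suc k < length ch \<Longrightarrow> neighbors (ch ! k) (ch ! Suc k)"
    and pos: "\<And>P. P \<in> set ch \<Longrightarrow> 0 < side P" and ij: "i \<le> j" "j < length ch"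
  shows "dist (fst (ch ! i)) (fst (ch ! j)) \<le> real DIM('a) * (\<Sum>k<length ch. side (ch ! k))"
proof -
  let ?d = "real DIM('a)"
  \<comment> \<open>A step between neighbors costs half of both sides. The extra half side of the
    last cube pays the first half of the next step, so each cube is charged once.\<close>
  have "dist (fst (ch ! i)) (fst (ch ! j)) + ?d * (side (ch ! j) / 2) \<le> ?d * (\<Sum>k\<in>{i..j}. side (ch ! k))"
    using ij
  proof (induction j rule: dec_induct)
    case base
    then show ?case using pos[of "ch ! i"] by simp
  next
    case (step n)
    have "dist (fst (ch ! i)) (fst (ch ! Suc n)) \<le> dist (fst (ch ! i)) (fst (ch ! n)) + dist (fst (ch ! n)) (fst (ch ! Suc n))"
      by (rule dist_triangle)
    moreover have "dist (fst (ch ! n)) (fst (ch ! Suc n)) \<le> ?d * (side (ch ! n) / 2) + ?d * (side (ch ! Suc n) / 2)"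
      using step.prems by (intro neighbors_dist_le nb)
    moreover have "dist (fst (ch ! i)) (fst (ch ! n)) + ?d * (side (ch ! n) / 2) \<le> ?d * (\<Sum>k\<in>{i..n}. side (ch ! k))"
      using step by simp
    ultimately have "dist (fst (ch ! i)) (fst (ch ! Suc n)) + ?d * (side (ch ! Suc n) / 2)
        \<le> ?d * (\<Sum>k\<in>{i..n}. side (ch ! k)) + ?d * side (ch ! Suc n)"
      by linarith
    also have "\<dots> = ?d * (\<Sum>k\<in>{i..Suc n}. side (ch ! k))"
      using step.hyps by (simp add: distrib_left)
    finally show ?case .
  qed
  also have "?d * (\<Sum>k\<in>{i..j}. side (ch ! k)) \<le> ?d * (\<Sum>k<length ch. side (ch ! k))"
    using ij pos[OF nth_mem] by (intro mult_left_mono sum_mono2) (auto simp: less_imp_le)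
  finally show ?thesis
  proof (rule order_trans[rotated])
    have "0 \<le> ?d * (side (ch ! j) / 2)"
      using pos[OF nth_mem[OF ij(2)]] by simp
    then show "dist (fst (ch ! i)) (fst (ch ! j)) \<le> dist (fst (ch ! i)) (fst (ch ! j)) + ?d * (side (ch ! j) / 2)"
      by linarith
  qed
qed

text \<open>Extracts from admissibility three conditions on a single cube \<open>P\<close>, free of
  its position in the chain. The factor d + 2 adds d times the total side (distance of centres) and
  one total side for each of the two cubes; d + 1 comes from comparing \<open>cube_gap\<close> with
  \<open>Dcubes\<close>.\<close>

lemma admissible_chain_cube_gap:
  fixes W :: "('a::euclidean_space \<times> real) set"
  assumes adm: "admissible_chain \<epsilon> W ch Q S" and pos: "\<And>P. P \<in> W \<Longrightarrow> 0 < side P"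
    and \<epsilon>: "0 < \<epsilon>" and P: "P \<in> set ch"
  shows "cube_gap Q P \<le> (real DIM('a) + 2) / \<epsilon> * cube_gap Q S"
    and "cube_gap P S \<le> (real DIM('a) + 2) / \<epsilon> * cube_gap Q S"
    and "\<epsilon> / (real DIM('a) + 1) * cube_gap Q P \<le> side P \<or> \<epsilon> / (real DIM('a) + 1) * cube_gap P S \<le> side P"
proof -
  let ?d = "real DIM('a)" and ?\<Sigma> = "\<Sum>k<length ch. side (ch ! k)"
  have ch: "ch \<noteq> []" "set ch \<subseteq> W" "hd ch = Q" "last ch = S"
    and nb: "\<And>k. Suc k < length ch \<Longrightarrow> neighbors (ch ! k) (ch ! Suc k)"
    using adm by (auto simp: admissible_chain_def is_chain_def)
  have Q: "ch ! 0 = Q" and S: "ch ! (length ch - 1) = S"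
    using ch by (simp_all add: hd_conv_nth last_conv_nth)
  obtain j where j: "j < length ch" "ch ! j = P" using P by (auto simp: in_set_conv_nth)
  have posc: "\<And>P. P \<in> set ch \<Longrightarrow> 0 < side P" using ch pos by auto
  have QW: "Q \<in> set ch" "S \<in> set ch" using ch by auto
  have le: "side X \<le> ?\<Sigma>" if X: "X \<in> set ch" for X
  proof -
    obtain k where "k < length ch" "ch ! k = X" using X by (auto simp: in_set_conv_nth)
    then show ?thesis
      using member_le_sum[of k "{..<length ch}" "\<lambda>k. side (ch ! k)"] posc[OF nth_mem]
      by (simp add: less_imp_le)
  qed
  have \<Sigma>: "?\<Sigma> \<le> cube_gap Q S / \<epsilon>"
  proof -
    have "?\<Sigma> \<le> Dcubes Q S / \<epsilon>" using adm by (simp add: admissible_chain_def)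
    also have "\<dots> \<le> cube_gap Q S / \<epsilon>"
      using Dcubes_le_cube_gap[of Q S] posc QW \<epsilon> by (intro divide_right_mono) auto
    finally show ?thesis .
  qed
  have fin: "(?d + 2) * ?\<Sigma> \<le> (?d + 2) / \<epsilon> * cube_gap Q S"
    using mult_left_mono[OF \<Sigma>, of "?d + 2"] by simp
  have "dist (fst Q) (fst P) \<le> ?d * ?\<Sigma>"
    using dist_in_chain_le[of ch 0 j] nb posc j Q by auto
  then have "cube_gap Q P \<le> (?d + 2) * ?\<Sigma>"
    using le[OF QW(1)] le[OF P] by (simp add: cube_gap_def algebra_simps)
  then show "cube_gap Q P \<le> (?d + 2) / \<epsilon> * cube_gap Q S" using fin by simp
  have "dist (fst P) (fst S) \<le> ?d * ?\<Sigma>"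
    using dist_in_chain_le[of ch j "length ch - 1"] nb posc j S by auto
  then have "cube_gap P S \<le> (?d + 2) * ?\<Sigma>"
    using le[OF QW(2)] le[OF P] by (simp add: cube_gap_def algebra_simps)
  then show "cube_gap P S \<le> (?d + 2) / \<epsilon> * cube_gap Q S" using fin by simp
  have cmp: "\<epsilon> / (?d + 1) * cube_gap X Y \<le> \<epsilon> * Dcubes X Y" if "X \<in> set ch" "Y \<in> set ch" for X Y
  proof -
    have "\<epsilon> / (?d + 1) * cube_gap X Y \<le> \<epsilon> / (?d + 1) * ((?d + 1) * Dcubes X Y)"
      using cube_gap_le_Dcubes[of X Y] posc that \<epsilon> by (intro mult_left_mono) auto
    then show ?thesis by (simp add: add_pos_nonneg)
  qed
  obtain j0 where "\<forall>j\<le>j0. side (ch ! j) \<ge> \<epsilon> * Dcubes (ch ! 0) (ch ! j)"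
    "\<forall>j. j0 \<le> j \<and> j < length ch \<longrightarrow> side (ch ! j) \<ge> \<epsilon> * Dcubes (ch ! j) (ch ! (length ch - 1))"
    using adm by (auto simp: admissible_chain_def)
  then have "side P \<ge> \<epsilon> * Dcubes Q P \<or> side P \<ge> \<epsilon> * Dcubes P S"
    unfolding Q S using j by (cases "j \<le> j0") auto
  then show "\<epsilon> / (?d + 1) * cube_gap Q P \<le> side P \<or> \<epsilon> / (?d + 1) * cube_gap P S \<le> side P"
    using cmp[OF QW(1) P] cmp[OF P QW(2)] by linarith
qed

text \<open>The bound on \<open>side S\<close> comes from the covering condition on cubes inside a dilate: a cube
  \<open>S\<close> much larger than its distance to \<open>Q\<close> would contain \<open>Q\<close> in its dilate.\<close>

lemma cube_gap_le_norm:
  fixes Q S :: "'a::euclidean_space \<times> real"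
  assumes pos: "0 < side Q" "0 < side S"
    and small: "ocube Q \<subseteq> ocube (dil 5 S) \<Longrightarrow> side S / 2 \<le> side Q"
    and x: "x \<in> ocube Q" and y: "y \<in> ocube S" "y \<notin> ocube (dil 5 Q)"
  shows "cube_gap Q S \<le> (real DIM('a) + 2)^2 * norm (x - y)"
proof -
  let ?d = "real DIM('a)" and ?N = "norm (x - y)"
  have N: "\<bar>x \<bullet> i - y \<bullet> i\<bar> \<le> ?N" if "i \<in> Basis" for i
    using Basis_le_norm[OF that, of "x - y"] by (simp add: inner_diff_left)
  have Q: "2 * side Q \<le> ?N"
  proof -
    obtain i where i: "i \<in> Basis" "\<not> \<bar>y \<bullet> i - fst Q \<bullet> i\<bar> < 5 * side Q / 2"
      using y by (auto simp: ocube_def dil_def side_def)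
    have "\<bar>x \<bullet> i - fst Q \<bullet> i\<bar> < side Q / 2" using x i by (simp add: ocube_def side_def)
    then show ?thesis using i N[OF i(1)] by linarith
  qed
  have S: "side S \<le> (?d + 1) * ?N"
  proof (cases "ocube Q \<subseteq> ocube (dil 5 S)")
    case True
    then have "side S \<le> ?N" using small Q by simp
    moreover have "0 \<le> ?d * ?N" by simp
    ultimately show ?thesis unfolding distrib_right by linarith
  next
    \<comment> \<open>A point \<open>x'\<close> of \<open>Q\<close> outside the dilate of
      \<open>S\<close> differs from \<open>y\<close> by at least 2 \<open>side S\<close> in one
      coordinate, and replacing \<open>x'\<close> by \<open>x\<close> costs at most
      \<open>side Q\<close>, which is at most half of \<open>?N\<close>.\<close>
    case False
    then obtain x' where x': "x' \<in> ocube Q" "x' \<notin> ocube (dil 5 S)" by auto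
    then obtain i where i: "i \<in> Basis" "\<not> \<bar>x' \<bullet> i - fst S \<bullet> i\<bar> < 5 * side S / 2"
      by (auto simp: ocube_def dil_def side_def)
    have "\<bar>y \<bullet> i - fst S \<bullet> i\<bar> < side S / 2" "\<bar>x \<bullet> i - fst Q \<bullet> i\<bar> < side Q / 2"
      "\<bar>x' \<bullet> i - fst Q \<bullet> i\<bar> < side Q / 2"
      using x y x' i by (auto simp: ocube_def side_def)
    then have "2 * side S \<le> ?N + side Q" using i N[OF i(1)] by linarith
    then have "side S \<le> ?N" using Q pos by simp
    moreover have "0 \<le> ?d * ?N" by simp
    ultimately show ?thesis unfolding distrib_right by linarith
  qed
  have "x \<in> ccube Q" "y \<in> ccube S" using x y by (simp_all add: mem_ocube_imp_ccube)
  from this[THEN dist_le_of_mem_ccube]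
  have "dist (fst Q) (fst S) \<le> ?d * (side Q / 2) + ?N + ?d * (side S / 2)"
    using dist_triangle[of "fst Q" "fst S" x] dist_triangle[of x "fst S" y]
    by (simp add: dist_commute dist_norm)
  also have "\<dots> \<le> ?d * ?N + ?N + ?d * ((?d + 1) * ?N)"
    using Q S pos by (intro add_mono mult_left_mono) auto
  finally have "cube_gap Q S \<le> ?N + (?d + 1) * ?N + (?d * ?N + ?N + ?d * ((?d + 1) * ?N))"
    using Q S pos by (simp add: cube_gap_def)
  also have "\<dots> \<le> (?d + 2)^2 * ?N"
  proof -
    have "0 \<le> ?d * ?N" by simp
    moreover have "(?d + 2)^2 * ?N - (?N + (?d + 1) * ?N + (?d * ?N + ?N + ?d * ((?d + 1) * ?N))) = ?d * ?N + ?N"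
      by (simp add: power2_eq_square algebra_simps)
    ultimately show ?thesis using norm_ge_zero[of "x - y"] by linarith
  qed
  finally show ?thesis .
qed

subsection \<open>The kernel operator on families of cubes\<close>

definition gap_kernel :: "real \<Rightarrow> 'a::euclidean_space \<times> real \<Rightarrow> 'a \<times> real \<Rightarrow> real" where
  "gap_kernel s Q S = (side S / cube_gap Q S) powr (s + real DIM('a))"

text \<open>The common constant of \<open>sum_far_le\<close> and \<open>sum_near_le\<close> for A =
  2^d, the growth constant of \<open>sum_volume_near_cube\<close>.\<close>

definition gap_const :: "real \<Rightarrow> real \<Rightarrow> real" where
  "gap_const d s = 2 powr d * 2 powr d / (1 - 2 powr - s)"

lemma gap_const_nonneg: "0 < s \<Longrightarrow> 0 \<le> gap_const d s"
  using powr_less_one[of 2 "- s"] by (simp add: gap_const_def)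

lemma gap_kernel_nonneg: "0 \<le> gap_kernel s Q S"
  by (simp add: gap_kernel_def)

lemma gap_kernel_eq:
  fixes Q :: "'a::euclidean_space \<times> real"
  assumes "0 < side Q" "0 < side S"
  shows "gap_kernel s Q S = side S powr s * side S powr real DIM('a) * cube_gap Q S powr (- s - real DIM('a))"
proof -
  have "- s - real DIM('a) = - (s + real DIM('a))" by simp
  then show ?thesis
    using assms cube_gap_pos[OF assms]
    by (simp only: gap_kernel_def powr_divide powr_minus powr_add less_imp_le) (simp add: divide_inverse)
qed

lemma sum_gap_far_le:
  fixes Q :: "'a::euclidean_space \<times> real"
  assumes dc: "disjoint_cubes V" and Q: "0 < side Q" and s: "0 < s" and R: "0 < R"
  shows "(\<Sum>S\<in>{S\<in>V. R \<le> cube_gap Q S}. side S powr real DIM('a) * cube_gap Q S powr (- s - real DIM('a)))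
       \<le> gap_const (real DIM('a)) s * R powr - s"
  unfolding gap_const_def
proof (rule sum_far_le)
  show "(\<Sum>i\<in>{S \<in> V. cube_gap Q S \<le> \<rho>}. side i powr real DIM('a)) \<le> 2 powr real DIM('a) * \<rho> powr real DIM('a)"
    if "0 < \<rho>" for \<rho>
    by (rule sum_volume_near_cube[OF dc Q that])
qed (use dc s R in \<open>auto simp: disjoint_cubes_def\<close>)

lemma sum_gap_near_le:
  fixes Q :: "'a::euclidean_space \<times> real"
  assumes dc: "disjoint_cubes V" and Q: "0 < side Q" and s: "0 < s" and R: "0 < R"
  shows "(\<Sum>S\<in>{S\<in>V. cube_gap Q S \<le> R}. side S powr real DIM('a) * cube_gap Q S powr (s - real DIM('a)))
       \<le> gap_const (real DIM('a)) s * R powr s"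
  unfolding gap_const_def
proof (rule sum_near_le)
  show "(\<Sum>i\<in>{S \<in> V. cube_gap Q S \<le> \<rho>}. side i powr real DIM('a)) \<le> 2 powr real DIM('a) * \<rho> powr real DIM('a)"
    if "0 < \<rho>" for \<rho>
    by (rule sum_volume_near_cube[OF dc Q that])
qed (use dc Q s R in \<open>auto simp: disjoint_cubes_def cube_gap_pos\<close>)

text \<open>Every gap from \<open>Q\<close> is at least \<open>side Q\<close>, so at this radius the
  far sum is the whole sum.\<close>

lemma sum_gap_all_le:
  fixes Q :: "'a::euclidean_space \<times> real"
  assumes dc: "disjoint_cubes V" and Q: "0 < side Q" and s: "0 < s"
  shows "(\<Sum>S\<in>V. side S powr real DIM('a) * cube_gap Q S powr (- s - real DIM('a)))
       \<le> gap_const (real DIM('a)) s * side Q powr - s"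
proof -
  have "{S\<in>V. side Q \<le> cube_gap Q S} = V"
    using dc Q side_le_cube_gap(1)[of Q] by (auto simp: disjoint_cubes_def less_imp_le)
  then show ?thesis using sum_gap_far_le[OF dc Q s Q] by simp
qed

text \<open>Boundedness of \<open>T\<close> on the weighted sequence space. Columns are far sums
  seen from \<open>S\<close>. For the tails, a cube \<open>Z\<close> at least as far from
  \<open>Q\<close> as \<open>S\<close> satisfies \<open>cube_gap S Z \<le> 2 * cube_gap Q Z\<close>
  by the triangle inequality, whence the factor 2^(s + d).\<close>

lemma gap_kernel_operator_bound:
  fixes V :: "('a::euclidean_space \<times> real) set"
  assumes dc: "disjoint_cubes V" and s: "0 < s" and r: "1 \<le> r" and h: "\<And>Q. Q \<in> V \<Longrightarrow> 0 \<le> h Q"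
  shows "(\<Sum>Q\<in>V. side Q powr real DIM('a) * (\<Sum>S\<in>V. gap_kernel s Q S * h S) powr r)
       \<le> (2 * (r * (2 powr (s + real DIM('a))) powr (r - 1) * gap_const (real DIM('a)) s)) powr r
          * (\<Sum>Q\<in>V. side Q powr real DIM('a) * h Q powr r)"
proof (rule sum_operator_powr_bound[where D = cube_gap])
  let ?d = "real DIM('a)"
  have pos: "\<And>S. S \<in> V \<Longrightarrow> 0 < side S" and V: "finite V"
    using dc by (auto simp: disjoint_cubes_def)
  show "finite V" by (rule V)
  fix S assume S: "S \<in> V"
  have "(\<Sum>Q\<in>V. side Q powr ?d * gap_kernel s Q S)
      = (side S powr s * side S powr ?d) * (\<Sum>Q\<in>V. side Q powr ?d * cube_gap S Q powr (- s - ?d))"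
    unfolding sum_distrib_left using pos S
    by (intro sum.cong) (simp_all add: gap_kernel_eq cube_gap_commute[of _ S])
  also have "\<dots> \<le> (side S powr s * side S powr ?d) * (gap_const ?d s * side S powr - s)"
    using pos[OF S] by (intro mult_left_mono sum_gap_all_le[OF dc _ s]) auto
  also have "\<dots> = gap_const ?d s * side S powr ?d"
    using pos[OF S] by (simp add: powr_minus_divide)
  finally show "(\<Sum>Q\<in>V. side Q powr ?d * gap_kernel s Q S) \<le> gap_const ?d s * side S powr ?d" .
next
  let ?d = "real DIM('a)"
  have pos: "\<And>S. S \<in> V \<Longrightarrow> 0 < side S"
    using dc by (auto simp: disjoint_cubes_def)
  fix Q S Z assume V: "Q \<in> V" "S \<in> V" "Z \<in> V" and le: "cube_gap Q S \<le> cube_gap Q Z"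
  have "cube_gap S Z \<le> 2 * cube_gap Q Z"
    using cube_gap_triangle[of Q S Z] pos[OF V(1)] le by (simp add: cube_gap_commute)
  then have "side Z / cube_gap Q Z \<le> 2 * (side Z / cube_gap S Z)"
    using pos V cube_gap_pos[of S Z] cube_gap_pos[of Q Z] by (simp add: field_simps)
  then have "gap_kernel s Q Z \<le> (2 * (side Z / cube_gap S Z)) powr (s + ?d)"
    unfolding gap_kernel_def using s pos V cube_gap_pos[of Q Z]
    by (intro powr_mono2) (auto simp: less_imp_le)
  also have "\<dots> = 2 powr (s + ?d) * gap_kernel s S Z"
    using pos V cube_gap_pos[of S Z] by (subst powr_mult) (auto simp: gap_kernel_def less_imp_le)
  finally show "gap_kernel s Q Z \<le> 2 powr (s + ?d) * gap_kernel s S Z" .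
qed (use r h s in \<open>auto simp: gap_kernel_nonneg gap_const_nonneg\<close>)

text \<open>Summing over the set of cubes met, not over the chain with multiplicity: loops are cut.
  The extra summand \<open>b (hd ch)\<close> makes the induction go through.\<close>

lemma abs_diff_chain_le:
  fixes \<phi> b :: "'i \<Rightarrow> real"
  assumes "successively R ch" "ch \<noteq> []" "\<And>P. P \<in> set ch \<Longrightarrow> 0 \<le> b P"
    "\<And>P S. P \<in> set ch \<Longrightarrow> S \<in> set ch \<Longrightarrow> R P S \<Longrightarrow> \<bar>\<phi> P - \<phi> S\<bar> \<le> b P + b S"
  shows "\<bar>\<phi> (hd ch) - \<phi> (last ch)\<bar> + b (hd ch) \<le> 2 * (\<Sum>P\<in>set ch. b P)"
  using assms
proof (induction ch rule: length_induct)
  case (1 ch)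
  obtain Q ys where ch: "ch = Q # ys" using 1(3) by (cases ch) auto
  show ?case
  proof (cases "Q \<in> set ys")
    case True
    then obtain us vs where ys: "ys = us @ Q # vs" by (meson split_list)
    have "\<bar>\<phi> (hd (Q # vs)) - \<phi> (last (Q # vs))\<bar> + b (hd (Q # vs)) \<le> 2 * (\<Sum>P\<in>set (Q # vs). b P)"
    proof (rule 1(1)[rule_format])
      show "successively R (Q # vs)"
        using 1(2) unfolding ch ys by (simp add: successively_Cons successively_append_iff split: if_splits)
    qed (use 1(4,5) in \<open>auto simp: ch ys\<close>)
    also have "\<dots> \<le> 2 * (\<Sum>P\<in>set ch. b P)"
      using 1(4) by (intro mult_left_mono sum_mono2) (auto simp: ch ys)
    finally show ?thesis by (simp add: ch ys)
  next
    case False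
    show ?thesis
    proof (cases "ys = []")
      case True
      then show ?thesis using 1(4)[of Q] by (simp add: ch)
    next
      case ne: False
      have "\<bar>\<phi> (hd ys) - \<phi> (last ys)\<bar> + b (hd ys) \<le> 2 * (\<Sum>P\<in>set ys. b P)"
        by (rule 1(1)[rule_format]) (use 1(2,4,5) ne in \<open>auto simp: ch successively_Cons\<close>)
      moreover have "\<bar>\<phi> Q - \<phi> (hd ys)\<bar> \<le> b Q + b (hd ys)"
        using 1(2) ne by (intro 1(5)) (auto simp: ch successively_Cons)
      ultimately show ?thesis
        using False ne by (simp add: ch)
    qed
  qed
qed

text \<open>Three sources: 2^q from the factor 2 in \<open>abs_diff_chain_le\<close>; the power q -
  1 of the constant in \<open>sum_side_powr_linking_le\<close>, from Hoelder's inequality; the last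
  factor from \<open>sum_kernel_over_linked_le\<close>.\<close>

definition chain_const :: "real \<Rightarrow> real \<Rightarrow> real \<Rightarrow> real \<Rightarrow> real \<Rightarrow> real" where
  "chain_const d s q C e = 2 powr q * (2 * (e powr - d * gap_const d s * C powr s)) powr (q - 1)
     * (gap_const d s * C powr s * e powr - d + 2 powr d * C powr (s + d) * e powr - d)"

text \<open>Replaces the chosen chain by all cubes that could lie on an admissible one. Membership
  is an explicit relation between \<open>P\<close>, \<open>Q\<close> and \<open>S\<close>, so it can
  be summed over \<open>S\<close> with \<open>P\<close> fixed.\<close>

definition linking_cubes :: "('a::euclidean_space \<times> real) set \<Rightarrow> real \<Rightarrow> real \<Rightarrow> 'a \<times> real \<Rightarrow> 'a \<times> real \<Rightarrow> ('a \<times> real) set" where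
  "linking_cubes V C e Q S = {P\<in>V. cube_gap Q P \<le> C * cube_gap Q S \<and> cube_gap P S \<le> C * cube_gap Q S \<and>
     (e * cube_gap Q P \<le> side P \<or> e * cube_gap P S \<le> side P)}"

text \<open>A cube comparable to its gap from \<open>Q\<close> has volume at least a multiple of
  gap^d. Its term is therefore at most a multiple of its volume times gap^(s - d), and the near sum
  applies.\<close>

lemma sum_side_powr_comparable_le:
  fixes Q :: "'a::euclidean_space \<times> real"
  assumes dc: "disjoint_cubes V" and Q: "0 < side Q" and s: "0 < s" and R: "0 < R" and e: "0 < e"
  shows "(\<Sum>P\<in>{P\<in>V. cube_gap Q P \<le> R \<and> e * cube_gap Q P \<le> side P}. side P powr s)
     \<le> e powr - real DIM('a) * gap_const (real DIM('a)) s * R powr s"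
proof -
  let ?d = "real DIM('a)"
  have pos: "\<And>S. S \<in> V \<Longrightarrow> 0 < side S" and V: "finite V"
    using dc by (auto simp: disjoint_cubes_def)
  have "(\<Sum>P\<in>{P\<in>V. cube_gap Q P \<le> R \<and> e * cube_gap Q P \<le> side P}. side P powr s)
     \<le> (\<Sum>P\<in>{P\<in>V. cube_gap Q P \<le> R \<and> e * cube_gap Q P \<le> side P}.
          e powr - ?d * (side P powr ?d * cube_gap Q P powr (s - ?d)))"
  proof (intro sum_mono, clarify)
    fix a b assume P: "(a, b) \<in> V" "e * cube_gap Q (a, b) \<le> side (a, b)"
    define P where "P = (a, b)"
    have g: "0 < cube_gap Q P" "0 < side P" using P pos Q by (auto simp: P_def cube_gap_pos)
    have "side P powr s \<le> cube_gap Q P powr s"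
      using g s Q by (intro powr_mono2 side_le_cube_gap) auto
    also have "\<dots> = e powr - ?d * ((e * cube_gap Q P) powr ?d * cube_gap Q P powr (s - ?d))"
    proof -
      have "cube_gap Q P powr ?d * cube_gap Q P powr (s - ?d) = cube_gap Q P powr s"
        by (simp flip: powr_add)
      moreover have "e powr - ?d * e powr ?d = 1"
        using e by (simp flip: powr_add)
      moreover have "(e * cube_gap Q P) powr ?d = e powr ?d * cube_gap Q P powr ?d"
        using e g by (simp add: powr_mult)
      ultimately show ?thesis
        by (metis mult.assoc mult.left_neutral)
    qed
    also have "\<dots> \<le> e powr - ?d * (side P powr ?d * cube_gap Q P powr (s - ?d))"
      using P e g by (intro mult_left_mono mult_right_mono powr_mono2) (auto simp: P_def)
    finally show "side (a, b) powr s \<le> e powr - ?d * (side (a, b) powr ?d * cube_gap Q (a, b) powr (s - ?d))"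
      by (simp add: P_def)
  qed
  also have "\<dots> \<le> (\<Sum>P\<in>{P\<in>V. cube_gap Q P \<le> R}.
          e powr - ?d * (side P powr ?d * cube_gap Q P powr (s - ?d)))"
    using V by (intro sum_mono2) auto
  also have "\<dots> \<le> e powr - ?d * (gap_const ?d s * R powr s)"
    unfolding sum_distrib_left[symmetric]
    by (intro mult_left_mono sum_gap_near_le[OF dc Q s R]) auto
  finally show ?thesis by (simp add: mult.assoc)
qed

text \<open>This is the total weight in Hoelder's inequality along a chain. The two alternatives in
  \<open>linking_cubes\<close> give one near sum around \<open>Q\<close> and one around
  \<open>S\<close>.\<close>

lemma sum_side_powr_linking_le:
  fixes Q S :: "'a::euclidean_space \<times> real"
  assumes dc: "disjoint_cubes V" and Q: "0 < side Q" and S: "0 < side S"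
    and s: "0 < s" and e: "0 < e" and C: "0 < C"
  shows "(\<Sum>P\<in>linking_cubes V C e Q S. side P powr s)
     \<le> 2 * (e powr - real DIM('a) * gap_const (real DIM('a)) s * C powr s) * cube_gap Q S powr s"
proof -
  let ?d = "real DIM('a)" and ?R = "C * cube_gap Q S"
  have V: "finite V" using dc by (auto simp: disjoint_cubes_def)
  have R: "0 < ?R" using cube_gap_pos[OF Q S] C by simp
  have "(\<Sum>P\<in>linking_cubes V C e Q S. side P powr s)
     \<le> (\<Sum>P\<in>{P\<in>V. cube_gap Q P \<le> ?R \<and> e * cube_gap Q P \<le> side P}. side P powr s)
      + (\<Sum>P\<in>{P\<in>V. cube_gap S P \<le> ?R \<and> e * cube_gap S P \<le> side P}. side P powr s)"
    unfolding linking_cubes_def using V by (intro sum_filter_le_add) (auto simp: cube_gap_commute[of _ S])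
  also have "\<dots> \<le> e powr - ?d * gap_const ?d s * ?R powr s + e powr - ?d * gap_const ?d s * ?R powr s"
    by (intro add_mono sum_side_powr_comparable_le dc Q S s R e)
  also have "?R powr s = C powr s * cube_gap Q S powr s"
    using C cube_gap_pos[OF Q S] by (simp add: powr_mult less_imp_le)
  finally show ?thesis by (simp add: mult_ac)
qed

text \<open>If \<open>P\<close> is comparable to its gap from \<open>Q\<close>, the admissible
  \<open>S\<close> stay at gap at least \<open>cube_gap Q P / C\<close> from \<open>Q\<close>, and
  the far sum decays as required. If \<open>P\<close> is comparable to its gap from
  \<open>S\<close>, all such \<open>S\<close> lie within \<open>side P / e\<close> of
  \<open>P\<close>, so their volume is at most a multiple of that of \<open>P\<close>, while the
  kernel is at most its value at gap \<open>cube_gap Q P / C\<close>.\<close>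

lemma sum_kernel_over_linked_le:
  fixes Q P :: "'a::euclidean_space \<times> real"
  assumes dc: "disjoint_cubes V" and Q: "0 < side Q" and P: "0 < side P"
    and s: "0 < s" and e: "0 < e" and C: "0 < C"
  shows "(\<Sum>S\<in>{S\<in>V. P \<in> linking_cubes U C e Q S}. side S powr real DIM('a) * cube_gap Q S powr (- s - real DIM('a)))
     \<le> (gap_const (real DIM('a)) s * C powr s * e powr - real DIM('a)
          + 2 powr real DIM('a) * C powr (s + real DIM('a)) * e powr - real DIM('a))
        * (side P powr real DIM('a) * cube_gap Q P powr (- s - real DIM('a)))"
proof -
  let ?d = "real DIM('a)" and ?g = "cube_gap Q P"
  let ?f = "\<lambda>S. side S powr ?d * cube_gap Q S powr (- s - ?d)"
  have pos: "\<And>S. S \<in> V \<Longrightarrow> 0 < side S" and V: "finite V"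
    using dc by (auto simp: disjoint_cubes_def)
  have g: "0 < ?g" using Q P by (rule cube_gap_pos)
  have gs: "?g powr - s = ?g powr (- s - ?d) * ?g powr ?d"
    by (simp flip: powr_add)
  have far: "sum ?f {S\<in>V. ?g / C \<le> cube_gap Q S \<and> e * ?g \<le> side P}
      \<le> gap_const ?d s * C powr s * e powr - ?d * (side P powr ?d * ?g powr (- s - ?d))"
  proof (cases "e * ?g \<le> side P")
    case True
    have "sum ?f {S\<in>V. ?g / C \<le> cube_gap Q S} \<le> gap_const ?d s * (?g / C) powr - s"
      using g C by (intro sum_gap_far_le dc Q s) auto
    also have "(?g / C) powr - s = C powr s * e powr - ?d * ((e * ?g) powr ?d * ?g powr (- s - ?d))"
    proof -
      have "(?g / C) powr - s = C powr s * ?g powr - s"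
        using C g by (simp add: powr_divide powr_minus_divide)
      moreover have "e powr - ?d * e powr ?d = 1"
        using e by (simp flip: powr_add)
      ultimately show ?thesis
        using e g by (simp add: powr_mult less_imp_le gs)
    qed
    also have "gap_const ?d s * \<dots> \<le> gap_const ?d s * (C powr s * e powr - ?d * (side P powr ?d * ?g powr (- s - ?d)))"
      using True e g s by (intro mult_left_mono mult_right_mono powr_mono2) (auto simp: gap_const_nonneg)
    finally show ?thesis using True by (simp add: mult.assoc)
  qed (use s in \<open>auto simp: gap_const_nonneg\<close>)
  have near: "sum ?f {S\<in>V. ?g / C \<le> cube_gap Q S \<and> cube_gap P S \<le> side P / e}
      \<le> 2 powr ?d * C powr (s + ?d) * e powr - ?d * (side P powr ?d * ?g powr (- s - ?d))"
  proof -
    have "sum ?f {S\<in>V. ?g / C \<le> cube_gap Q S \<and> cube_gap P S \<le> side P / e}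
        \<le> (\<Sum>S\<in>{S\<in>V. ?g / C \<le> cube_gap Q S \<and> cube_gap P S \<le> side P / e}. side S powr ?d * (?g / C) powr (- s - ?d))"
      using g C s by (intro sum_mono mult_left_mono powr_mono2') auto
    also have "\<dots> \<le> (\<Sum>S\<in>{S\<in>V. cube_gap P S \<le> side P / e}. side S powr ?d) * (?g / C) powr (- s - ?d)"
      unfolding sum_distrib_right[symmetric] using V by (intro mult_right_mono sum_mono2) auto
    also have "\<dots> \<le> 2 powr ?d * (side P / e) powr ?d * (?g / C) powr (- s - ?d)"
      using P e by (intro mult_right_mono sum_volume_near_cube dc) auto
    also have "(side P / e) powr ?d = side P powr ?d * e powr - ?d"
      using P e by (simp add: powr_divide powr_minus_divide)
    also have "(?g / C) powr (- s - ?d) = ?g powr (- s - ?d) * C powr (s + ?d)"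
    proof -
      have "- s - ?d = - (s + ?d)" by simp
      then show ?thesis using g C by (simp only: powr_divide powr_minus less_imp_le) (simp add: divide_inverse)
    qed
    finally show ?thesis by (simp add: mult_ac)
  qed
  have "sum ?f {S\<in>V. P \<in> linking_cubes U C e Q S}
      \<le> sum ?f {S\<in>V. ?g / C \<le> cube_gap Q S \<and> e * ?g \<le> side P}
       + sum ?f {S\<in>V. ?g / C \<le> cube_gap Q S \<and> cube_gap P S \<le> side P / e}"
    using V C e by (intro sum_filter_le_add) (auto simp: linking_cubes_def field_simps)
  also note far also note near
  finally show ?thesis by (simp add: distrib_right)
qed

text \<open>Endpoints \<open>S\<close> range over \<open>V\<close> and intermediate cubes over
  \<open>U\<close>. After Hoelder's inequality the order of summation is exchanged, and summing over
  \<open>S\<close> for fixed \<open>P\<close> leaves the kernel of the operator at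
  \<open>P\<close>.\<close>

lemma sum_chain_differences_le:
  fixes \<phi> :: "'a::euclidean_space \<times> real \<Rightarrow> real"
  assumes dc: "disjoint_cubes U" and VU: "V \<subseteq> U" and Q: "Q \<in> U" and h: "\<And>P. P \<in> U \<Longrightarrow> 0 \<le> h P"
    and s: "0 < s" and q: "1 \<le> q" and C: "0 < C" and e: "0 < e" and M: "0 \<le> M"
    and nb: "\<And>P S. P \<in> U \<Longrightarrow> S \<in> U \<Longrightarrow> neighbors P S \<Longrightarrow>
       \<bar>\<phi> P - \<phi> S\<bar> \<le> M * (side P powr s * h P powr (1 / q)) + M * (side S powr s * h S powr (1 / q))"
    and link: "\<And>S. S \<in> V \<Longrightarrow> \<exists>ch. is_chain U ch Q S \<and> set ch \<subseteq> linking_cubes U C e Q S"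
  shows "(\<Sum>S\<in>V. side S powr real DIM('a) * cube_gap Q S powr (- (s * q) - real DIM('a)) * \<bar>\<phi> Q - \<phi> S\<bar> powr q)
     \<le> M powr q * chain_const (real DIM('a)) s q C e * (\<Sum>P\<in>U. gap_kernel s Q P * h P)"
proof -
  let ?d = "real DIM('a)"
  have pos: "\<And>S. S \<in> U \<Longrightarrow> 0 < side S" and U: "finite U"
    using dc by (auto simp: disjoint_cubes_def)
  have V: "finite V" using VU U by (rule finite_subset)
  then have dcV: "disjoint_cubes V"
    using dc VU unfolding disjoint_cubes_def by blast
  define u where "u = (\<lambda>P. side P powr s * h P powr (1 / q))"
  define K1 where "K1 = 2 * (e powr - ?d * gap_const ?d s * C powr s)"
  define K2 where "K2 = gap_const ?d s * C powr s * e powr - ?d + 2 powr ?d * C powr (s + ?d) * e powr - ?d"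
  have K1: "0 \<le> K1" using s by (simp add: K1_def gap_const_nonneg)
  have u0: "0 \<le> u P" for P by (simp add: u_def)
  have finL: "finite (linking_cubes U C e Q S)" for S
    using U by (simp add: linking_cubes_def)
  have LU: "linking_cubes U C e Q S \<subseteq> U" for S by (auto simp: linking_cubes_def)
  have hL: "0 \<le> h P" if "P \<in> linking_cubes U C e Q S" for P S
    using h[OF subsetD[OF LU that]] .
  have diff: "\<bar>\<phi> Q - \<phi> S\<bar> powr q \<le> (2 * M) powr q * (K1 powr (q - 1) * cube_gap Q S powr (s * (q - 1))
       * (\<Sum>P\<in>linking_cubes U C e Q S. side P powr s * h P))" if S: "S \<in> V" for S
  proof -
    obtain ch where ch: "is_chain U ch Q S" "set ch \<subseteq> linking_cubes U C e Q S" using link[OF S] by auto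
    have sub: "set ch \<subseteq> U" and ne: "ch \<noteq> []" and ends: "hd ch = Q" "last ch = S"
      using ch by (auto simp: is_chain_def)
    have "\<bar>\<phi> (hd ch) - \<phi> (last ch)\<bar> + M * u (hd ch) \<le> 2 * (\<Sum>P\<in>set ch. M * u P)"
    proof (rule abs_diff_chain_le[where R = neighbors])
      show "successively neighbors ch"
        using ch(1) by (auto simp: is_chain_def successively_conv_nth)
      show "\<bar>\<phi> P - \<phi> T\<bar> \<le> M * u P + M * u T" if "P \<in> set ch" "T \<in> set ch" "neighbors P T" for P T
        unfolding u_def using that sub by (intro nb) auto
    qed (use ne M u0 in auto)
    moreover have "0 \<le> M * u (hd ch)" using M u0 by simp
    ultimately have "\<bar>\<phi> Q - \<phi> S\<bar> \<le> 2 * M * (\<Sum>P\<in>set ch. u P)"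
      by (simp add: ends sum_distrib_left mult.assoc)
    \<comment> \<open>From here on the particular chain is forgotten.\<close>
    also have "\<dots> \<le> 2 * M * (\<Sum>P\<in>linking_cubes U C e Q S. u P)"
      using ch(2) finL M u0 by (intro mult_left_mono sum_mono2) auto
    finally have "\<bar>\<phi> Q - \<phi> S\<bar> powr q \<le> (2 * M * (\<Sum>P\<in>linking_cubes U C e Q S. u P)) powr q"
      using q by (intro powr_mono2) auto
    also have "\<dots> = (2 * M) powr q * (\<Sum>P\<in>linking_cubes U C e Q S. side P powr s * h P powr (1 / q)) powr q"
      using M u0 by (subst powr_mult) (auto intro!: sum_nonneg simp: u_def)
    \<comment> \<open>The weights are \<open>side P powr s\<close>: the first factor then has the
      size of \<open>cube_gap Q S powr s\<close> to the power q - 1, and \<open>h P\<close> returns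
      to the first power.\<close>
    also have "(\<Sum>P\<in>linking_cubes U C e Q S. side P powr s * h P powr (1 / q)) powr q
        \<le> (\<Sum>P\<in>linking_cubes U C e Q S. side P powr s) powr (q - 1)
          * (\<Sum>P\<in>linking_cubes U C e Q S. side P powr s * (h P powr (1 / q)) powr q)"
      using finL q by (intro powr_weighted_sum_le) auto
    also have "(\<Sum>P\<in>linking_cubes U C e Q S. side P powr s * (h P powr (1 / q)) powr q)
        = (\<Sum>P\<in>linking_cubes U C e Q S. side P powr s * h P)"
      using hL q by (intro sum.cong refl) (simp add: powr_powr)
    also have "(\<Sum>P\<in>linking_cubes U C e Q S. side P powr s) powr (q - 1)
        \<le> (K1 * cube_gap Q S powr s) powr (q - 1)"
      unfolding K1_def using q pos[OF Q] pos[OF subsetD[OF VU S]] s C e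
      by (intro powr_mono2 sum_side_powr_linking_le dc) (auto intro!: sum_nonneg)
    also have "(K1 * cube_gap Q S powr s) powr (q - 1) = K1 powr (q - 1) * cube_gap Q S powr (s * (q - 1))"
      using K1 by (simp add: powr_mult powr_powr)
    finally show ?thesis
      using hL by (simp add: mult_left_mono mult_right_mono sum_nonneg)
  qed
  have "(\<Sum>S\<in>V. side S powr ?d * cube_gap Q S powr (- (s * q) - ?d) * \<bar>\<phi> Q - \<phi> S\<bar> powr q)
      \<le> (\<Sum>S\<in>V. side S powr ?d * cube_gap Q S powr (- (s * q) - ?d) * ((2 * M) powr q
         * (K1 powr (q - 1) * cube_gap Q S powr (s * (q - 1))
         * (\<Sum>P\<in>linking_cubes U C e Q S. side P powr s * h P))))"
    using diff by (intro sum_mono mult_left_mono) auto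
  also have "\<dots> = (\<Sum>S\<in>V. \<Sum>P\<in>U. (2 * M) powr q * K1 powr (q - 1) * (side P powr s * h P)
        * (if P \<in> linking_cubes U C e Q S then side S powr ?d * cube_gap Q S powr (- s - ?d) else 0))"
  proof (intro sum.cong refl)
    fix S
    \<comment> \<open>Here s * q + d turns into s + d.\<close>
    have E: "cube_gap Q S powr (- (s * q) - ?d) * cube_gap Q S powr (s * (q - 1)) = cube_gap Q S powr (- s - ?d)"
      by (simp add: algebra_simps flip: powr_add)
    have eq: "side S powr ?d * cube_gap Q S powr (- (s * q) - ?d) * ((2 * M) powr q
         * (K1 powr (q - 1) * cube_gap Q S powr (s * (q - 1)) * X))
       = (2 * M) powr q * K1 powr (q - 1) * (side S powr ?d * cube_gap Q S powr (- s - ?d)) * X" for X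
      unfolding E[symmetric] by (simp only: mult_ac)
    show "side S powr ?d * cube_gap Q S powr (- (s * q) - ?d) * ((2 * M) powr q
         * (K1 powr (q - 1) * cube_gap Q S powr (s * (q - 1))
         * (\<Sum>P\<in>linking_cubes U C e Q S. side P powr s * h P)))
      = (\<Sum>P\<in>U. (2 * M) powr q * K1 powr (q - 1) * (side P powr s * h P)
        * (if P \<in> linking_cubes U C e Q S then side S powr ?d * cube_gap Q S powr (- s - ?d) else 0))"
      unfolding eq using U LU[of S]
      by (simp add: sum_distrib_left sum.inter_restrict[symmetric] if_distrib mult_ac
          Int_absorb1 cong: if_cong)
  qed
  also have "\<dots> = (\<Sum>P\<in>U. (2 * M) powr q * K1 powr (q - 1) * (side P powr s * h P)
        * (\<Sum>S\<in>{S\<in>V. P \<in> linking_cubes U C e Q S}. side S powr ?d * cube_gap Q S powr (- s - ?d)))"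
    by (subst sum.swap) (simp only: sum_distrib_left[symmetric] sum.inter_filter[OF V])
  also have "\<dots> \<le> (\<Sum>P\<in>U. (2 * M) powr q * K1 powr (q - 1) * (side P powr s * h P)
        * (K2 * (side P powr ?d * cube_gap Q P powr (- s - ?d))))"
    unfolding K2_def using pos Q s e C h
    by (intro sum_mono mult_left_mono sum_kernel_over_linked_le dcV) auto
  also have "\<dots> = (\<Sum>P\<in>U. (2 * M) powr q * K1 powr (q - 1) * K2 * (gap_kernel s Q P * h P))"
    using pos Q by (intro sum.cong) (auto simp: gap_kernel_eq)
  also have "\<dots> = M powr q * chain_const ?d s q C e * (\<Sum>P\<in>U. gap_kernel s Q P * h P)"
  proof -
    have "(2 * M) powr q * K1 powr (q - 1) * K2 = M powr q * chain_const ?d s q C e"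
    proof -
      have "(2 * M) powr q = 2 powr q * M powr q" using M by (simp add: powr_mult)
      then show ?thesis by (simp only: chain_const_def K1_def K2_def mult_ac)
    qed
    then show ?thesis by (simp only: sum_distrib_left)
  qed
  finally show ?thesis .
qed

subsection \<open>Means and local oscillation\<close>

lemma enn_powr_ennreal [simp]: "0 \<le> x \<Longrightarrow> enn_powr (ennreal x) t = ennreal (x powr t)"
  by (simp add: enn_powr_def)

lemma enn_powr_top [simp]: "enn_powr top t = top"
  by (simp add: enn_powr_def)

lemma enn_powr_measurable [measurable]: "(\<lambda>a. enn_powr a t) \<in> borel_measurable borel"
  unfolding enn_powr_def by measurable

lemma enn_powr_mono:
  assumes "0 \<le> t" "a \<le> b" shows "enn_powr a t \<le> enn_powr b t"
proof (cases "b = top")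
  case False
  then have "a \<noteq> top" using assms(2) by (auto simp: top_unique)
  then show ?thesis
    using False assms by (cases a; cases b) (auto intro!: ennreal_leI powr_mono2)
qed simp

lemma enn_powr_inverse:
  assumes "0 < t" shows "enn_powr (enn_powr a t) (1 / t) = a"
  using assms by (cases a) (auto simp: powr_powr)

lemma enn_powr_cmult:
  assumes "0 < c" "0 < t" shows "enn_powr (ennreal c * a) t = ennreal (c powr t) * enn_powr a t"
proof (cases a)
  case (real x)
  then show ?thesis
    using assms by (simp add: powr_mult flip: ennreal_mult)
next
  case top
  then show ?thesis using assms by (simp add: ennreal_mult_top)
qed

lemma enn_powr_add_le:
  assumes "0 \<le> t" shows "enn_powr (a + b) t \<le> ennreal (2 powr t) * (enn_powr a t + enn_powr b t)"
proof (cases "a = top \<or> b = top")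
  case True
  then show ?thesis by (auto simp: ennreal_mult_top)
next
  case False
  then obtain x y where xy: "a = ennreal x" "0 \<le> x" "b = ennreal y" "0 \<le> y"
    by (cases a; cases b) auto
  have "(x + y) powr t \<le> (2 * max x y) powr t"
    using assms xy by (intro powr_mono2) auto
  also have "\<dots> = 2 powr t * max x y powr t"
    using xy by (simp add: powr_mult)
  also have "\<dots> \<le> 2 powr t * (x powr t + y powr t)"
    by (intro mult_left_mono) (auto simp: max_def)
  finally show ?thesis
    using xy by (simp flip: ennreal_plus ennreal_mult)
qed

text \<open>Inverting the power reduces the claim to the least upper bound property of
  \<open>X\<close>; no continuity of the power is invoked.\<close>

lemma enn_powr_SUP_le:
  assumes t: "0 < t" and bound: "\<And>i. enn_powr (X i) t \<le> Y"
  shows "enn_powr (SUP i. X i) t \<le> Y"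
proof -
  have "X i \<le> enn_powr Y (1 / t)" for i
    using enn_powr_mono[OF _ bound, of "1 / t" i] t by (simp add: enn_powr_inverse)
  then have "(SUP i. X i) \<le> enn_powr Y (1 / t)" by (rule SUP_least)
  then have "enn_powr (SUP i. X i) t \<le> enn_powr (enn_powr Y (1 / t)) t"
    using t by (intro enn_powr_mono) auto
  also have "\<dots> = Y" using enn_powr_inverse[of "1 / t" Y] t by simp
  finally show ?thesis .
qed

text \<open>Jensen's inequality, integrating the tangent line of \<open>t \<mapsto> t powr r\<close> at the mean.\<close>

lemma nn_integral_mean_powr:
  assumes g [measurable]: "g \<in> borel_measurable M" and A [measurable]: "A \<in> sets M"
    and m: "emeasure M A = ennreal m" "0 < m" and r: "1 \<le> r"
    and fin: "(\<integral>\<^sup>+x\<in>A. enn_powr (g x) r \<partial>M) < \<infinity>"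
  obtains h where "0 \<le> h" "(\<integral>\<^sup>+x\<in>A. g x \<partial>M) = ennreal (h * m)"
    "ennreal (h powr r * m) \<le> (\<integral>\<^sup>+x\<in>A. enn_powr (g x) r \<partial>M)"
proof -
  let ?I = "\<integral>\<^sup>+x\<in>A. enn_powr (g x) r \<partial>M"
  obtain I where I: "?I = ennreal I" "0 \<le> I"
    using fin by (cases ?I) auto
  have tan: "ennreal (r * h powr (r - 1)) * (\<integral>\<^sup>+x\<in>A. g x \<partial>M) \<le> ennreal (I + (r - 1) * h powr r * m)" if h: "0 < h" for h
  proof -
    have pt: "ennreal (r * h powr (r - 1)) * g x \<le> enn_powr (g x) r + ennreal ((r - 1) * h powr r)" for x
    proof (cases "g x")
      case (real t)
      have "h powr r + r * h powr (r - 1) * (t - h) \<le> t powr r"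
        using powr_above_tangent[of t h r] real h r by simp
      moreover have e: "h powr r = h powr (r - 1) * h"
        using h by (simp add: powr_mult_base mult.commute)
      ultimately have "r * h powr (r - 1) * t \<le> t powr r + (r - 1) * h powr r"
        unfolding e by (simp add: algebra_simps)
      then show ?thesis using real r h by (simp flip: ennreal_mult ennreal_plus)
    qed simp
    have "ennreal (r * h powr (r - 1)) * (\<integral>\<^sup>+x\<in>A. g x \<partial>M) = (\<integral>\<^sup>+x\<in>A. ennreal (r * h powr (r - 1)) * g x \<partial>M)"
      by (subst nn_integral_cmult[symmetric]) (auto simp: mult.assoc)
    also have "\<dots> \<le> (\<integral>\<^sup>+x. enn_powr (g x) r * indicator A x + ennreal ((r - 1) * h powr r) * indicator A x \<partial>M)"
      using pt by (intro nn_integral_mono) (auto split: split_indicator)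
    also have "\<dots> = ?I + ennreal ((r - 1) * h powr r) * ennreal m"
      by (subst nn_integral_add) (auto simp: nn_integral_cmult_indicator m)
    also have "\<dots> = ennreal (I + (r - 1) * h powr r * m)"
      using I m r by (simp flip: ennreal_mult ennreal_plus)
    finally show ?thesis .
  qed
  \<comment> \<open>The tangent at 1 already bounds the integral; it must be finite before the mean
    can be used as a real tangent point.\<close>
  have "(\<integral>\<^sup>+x\<in>A. g x \<partial>M) \<noteq> top"
    using tan[of 1] r by (auto simp: ennreal_mult_top top_unique)
  then obtain J where J: "(\<integral>\<^sup>+x\<in>A. g x \<partial>M) = ennreal J" "0 \<le> J"
    by (cases "\<integral>\<^sup>+x\<in>A. g x \<partial>M") auto
  define h where "h = J / m"
  have h0: "0 \<le> h" and hm: "h * m = J" using J m by (auto simp: h_def)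
  have "h powr r * m \<le> I"
  proof (cases "h = 0")
    case False
    then have h: "0 < h" using h0 by simp
    have "r * h powr (r - 1) * J \<le> I + (r - 1) * h powr r * m"
    proof -
      have nn: "0 \<le> I + (r - 1) * h powr r * m" using I m r by simp
      have "ennreal (r * h powr (r - 1) * J) \<le> ennreal (I + (r - 1) * h powr r * m)"
        using tan[OF h] r J by (simp add: ennreal_mult)
      then show ?thesis using nn by (simp only: ennreal_le_iff)
    qed
    moreover have "h powr (r - 1) * h = h powr r"
      using h by (simp add: powr_mult_base mult.commute)
    then have "r * h powr (r - 1) * J = r * h powr r * m"
      by (simp flip: hm)
    moreover have "(r - 1) * h powr r * m = r * h powr r * m - h powr r * m"
      by (simp add: algebra_simps)
    ultimately show ?thesis by linarith
  qed (use I in simp)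
  then show ?thesis
    using that[OF h0] J hm I by (simp add: ennreal_leI)
qed

text \<open>If \<open>g\<close> exceeded its mean throughout a set of positive measure, the
  integrals would differ strictly. This selects the representative point of each cube.\<close>

lemma nn_integral_exists_le_mean:
  assumes g [measurable]: "g \<in> borel_measurable M" and A [measurable]: "A \<in> sets M"
    and m: "emeasure M A = ennreal m" "0 < m" and h: "0 \<le> h" "(\<integral>\<^sup>+x\<in>A. g x \<partial>M) = ennreal (h * m)"
  obtains x where "x \<in> A" "g x \<le> ennreal h"
proof (rule ccontr)
  assume neg: "\<not> thesis"
  note ex = that
  have gt: "ennreal h < g x" if "x \<in> A" for x
    using ex[OF that] neg by (meson not_le_imp_less)
  have hm: "(\<integral>\<^sup>+x. ennreal h * indicator A x \<partial>M) = ennreal (h * m)"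
    using m h by (simp add: nn_integral_cmult_indicator ennreal_mult)
  have "(\<integral>\<^sup>+x. ennreal h * indicator A x \<partial>M) < (\<integral>\<^sup>+x\<in>A. g x \<partial>M)"
  proof (rule nn_integral_less)
    show "\<not> (AE x in M. g x * indicator A x \<le> ennreal h * indicator A x)"
    proof
      assume "AE x in M. g x * indicator A x \<le> ennreal h * indicator A x"
      then have "AE x in M. x \<notin> A"
      proof eventually_elim
        case (elim x)
        then show ?case using gt[of x] by (auto simp: leD)
      qed
      then have "emeasure M A = 0"
        by (subst (asm) AE_iff_measurable[OF A]) (use sets.sets_into_space[OF A] in auto)
      then show False using m by simp
    qed
    show "AE x in M. ennreal h * indicator A x \<le> g x * indicator A x"
      using gt by (auto intro!: AE_I2 simp: less_imp_le split: split_indicator)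
  qed (use hm in auto)
  then show False using hm h by simp
qed

section \<open>Measurability of the kernel and the inner integral\<close>

lemma sigma_finite_lebesgue: "sigma_finite_measure (lebesgue :: 'a::euclidean_space measure)"
proof -
  obtain A :: "'a set set" where "countable A" "A \<subseteq> sets lborel" "\<Union>A = space lborel"
    "\<forall>a\<in>A. emeasure lborel a \<noteq> \<infinity>"
    using sigma_finite_lborel unfolding sigma_finite_measure_def by blast
  then show ?thesis
    unfolding sigma_finite_measure_def
    by (intro exI[of _ A]) (auto simp: subset_iff)
qed

lemma kernel_measurable_pair:
  fixes f :: "'a::euclidean_space \<Rightarrow> real"
  assumes [measurable]: "f \<in> borel_measurable lebesgue"
  shows "(\<lambda>z. ennreal (\<bar>f (fst z) - f (snd z)\<bar> powr q / norm (fst z - snd z) powr t))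
     \<in> borel_measurable (lebesgue \<Otimes>\<^sub>M lebesgue)"
proof -
  have id: "(\<lambda>x::'a. x) \<in> borel_measurable lebesgue"
    by (intro measurable_completion) simp
  have [measurable]: "fst \<in> borel_measurable ((lebesgue :: 'a measure) \<Otimes>\<^sub>M (lebesgue :: 'a measure))"
    by (rule measurable_compose[OF measurable_fst id])
  have [measurable]: "snd \<in> borel_measurable ((lebesgue :: 'a measure) \<Otimes>\<^sub>M (lebesgue :: 'a measure))"
    by (rule measurable_compose[OF measurable_snd id])
  have [measurable]: "(\<lambda>z. f (fst z)) \<in> borel_measurable (lebesgue \<Otimes>\<^sub>M lebesgue)"
    by (rule measurable_compose[OF measurable_fst assms])
  have [measurable]: "(\<lambda>z. f (snd z)) \<in> borel_measurable (lebesgue \<Otimes>\<^sub>M lebesgue)"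
    by (rule measurable_compose[OF measurable_snd assms])
  show ?thesis by measurable
qed

lemma kernel_measurable:
  fixes f :: "'a::euclidean_space \<Rightarrow> real"
  assumes "f \<in> borel_measurable lebesgue"
  shows "(\<lambda>y. ennreal (\<bar>f x - f y\<bar> powr q / norm (x - y) powr t)) \<in> borel_measurable lebesgue"
  using measurable_compose[OF measurable_Pair1'[of x lebesgue lebesgue] kernel_measurable_pair[OF assms]]
  by simp

lemma inner_int_measurable:
  fixes f :: "'a::euclidean_space \<Rightarrow> real"
  assumes f: "f \<in> borel_measurable lebesgue" and A: "A \<in> sets lebesgue"
  shows "inner_int f s q A \<in> borel_measurable lebesgue"
proof -
  interpret sigma_finite_measure "lebesgue :: 'a measure" by (rule sigma_finite_lebesgue)
  have [measurable]: "(\<lambda>z. indicator A (snd z) :: ennreal) \<in> borel_measurable ((lebesgue :: 'a measure) \<Otimes>\<^sub>M lebesgue)"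
    by (rule measurable_compose[OF measurable_snd borel_measurable_indicator[OF A]])
  have "(\<lambda>x. \<integral>\<^sup>+ y. (\<lambda>z. ennreal (\<bar>f (fst z) - f (snd z)\<bar> powr q / norm (fst z - snd z) powr (s * q + real DIM('a)))
       * indicator A (snd z)) (x, y) \<partial>lebesgue) \<in> borel_measurable lebesgue"
    by (rule borel_measurable_nn_integral) (use kernel_measurable_pair[OF f] in measurable)
  then show ?thesis
    unfolding inner_int_def by (simp add: fun_eq_iff[symmetric])
qed

lemma inner_int_mono: "A \<subseteq> B \<Longrightarrow> inner_int f s q A x \<le> inner_int f s q B x"
  unfolding inner_int_def by (intro nn_integral_mono mult_left_mono) (auto split: split_indicator)

text \<open>2^q comes from splitting the q-th power of a sum, (3d)^(s * q + d) from replacing |x -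
  z| by 3 d \<open>side P\<close>, and 2^d from averaging over a cube whose side may be half of
  \<open>side P\<close>.\<close>

definition local_const :: "real \<Rightarrow> real \<Rightarrow> real \<Rightarrow> real" where
  "local_const d s q = 2 powr q * (3 * d) powr (s * q + d) * 2 powr d"

lemma powr_add3_le:
  fixes a b c q :: real
  assumes "0 \<le> a" "0 \<le> b" "0 \<le> c" "0 \<le> q"
  shows "(a + b + c) powr q \<le> 3 powr q * (a powr q + b powr q + c powr q)"
proof -
  define m where "m = max a (max b c)"
  have "(a + b + c) powr q \<le> (3 * m) powr q"
    using assms by (intro powr_mono2) (auto simp: m_def)
  also have "\<dots> = 3 powr q * m powr q"
    using assms by (subst powr_mult) (auto simp: m_def)
  also have "\<dots> \<le> 3 powr q * (a powr q + b powr q + c powr q)"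
    by (intro mult_left_mono) (auto simp: m_def max_def)
  finally show ?thesis .
qed

lemma powr_add2_le:
  fixes a b q :: real
  assumes "0 \<le> a" "0 \<le> b" "0 \<le> q"
  shows "(a + b) powr q \<le> 2 powr q * (a powr q + b powr q)"
proof -
  have "(a + b) powr q \<le> (2 * max a b) powr q"
    using assms by (intro powr_mono2) auto
  also have "\<dots> = 2 powr q * max a b powr q"
    using assms by (simp add: powr_mult)
  also have "\<dots> \<le> 2 powr q * (a powr q + b powr q)"
    by (intro mult_left_mono) (auto simp: max_def)
  finally show ?thesis .
qed

text \<open>Multiply and divide by the power of the distance. On the diagonal the left side vanishes
  because q > 0, so the convention for division by zero does no harm.\<close>

lemma diff_powr_le_kernel:
  fixes f :: "'a::euclidean_space \<Rightarrow> real"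
  assumes q: "0 < q" and t: "0 \<le> t" and R: "norm (x - z) \<le> R"
  shows "ennreal (\<bar>f x - f z\<bar> powr q) \<le> ennreal (R powr t) * ennreal (\<bar>f x - f z\<bar> powr q / norm (x - z) powr t)"
proof (cases "x = z")
  case False
  have "\<bar>f x - f z\<bar> powr q = norm (x - z) powr t * (\<bar>f x - f z\<bar> powr q / norm (x - z) powr t)"
    using False by simp
  also have "\<dots> \<le> R powr t * (\<bar>f x - f z\<bar> powr q / norm (x - z) powr t)"
    using R t by (intro mult_right_mono powr_mono2) auto
  finally show ?thesis by (simp flip: ennreal_mult)
qed (use q in simp)

text \<open>Averaging \<open>|f x - f x'|\<close> over an intermediate point \<open>z\<close> of the smaller cube.\<close>

lemma local_oscillation_le:
  fixes f :: "'a::euclidean_space \<Rightarrow> real"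
  assumes f: "f \<in> borel_measurable lebesgue" and s: "0 < s" and q: "1 \<le> q"
    and P': "0 < side P'" "side P' \<le> side P" "side P \<le> 2 * side P'"
    and sub: "ocube P' \<subseteq> ocube (dil 5 P)" "ocube P' \<subseteq> \<Omega>"
    and x: "x \<in> ocube P" and x': "x' \<in> ocube P'"
  shows "ennreal (\<bar>f x - f x'\<bar> powr q) \<le> ennreal (local_const (real DIM('a)) s q * side P powr (s * q))
      * (inner_int f s q (ocube (dil 5 P) \<inter> \<Omega>) x + inner_int f s q (ocube (dil 5 P') \<inter> \<Omega>) x')"
proof -
  let ?d = "real DIM('a)" and ?k = "\<lambda>x z. ennreal (\<bar>f x - f z\<bar> powr q / norm (x - z) powr (s * q + real DIM('a)))"
  let ?X = "inner_int f s q (ocube (dil 5 P) \<inter> \<Omega>) x + inner_int f s q (ocube (dil 5 P') \<inter> \<Omega>) x'"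
  define B where "B = 2 powr q * (3 * ?d * side P) powr (s * q + ?d)"
  have [measurable]: "(\<lambda>z. ?k y z) \<in> borel_measurable lebesgue" for y
    by (rule kernel_measurable[OF f])
  \<comment> \<open>In each coordinate 1/2 + 5/2 = 3 sides, then the l1 bound for the norm.\<close>
  have near: "norm (y - z) \<le> 3 * ?d * side P" if "y \<in> ocube S" "z \<in> ocube (dil 5 S)" "side S \<le> side P" for y z :: 'a and S
  proof -
    have "norm (y - z) \<le> ?d * (3 * side P)"
    proof (rule norm_le_DIM_mult)
      fix i :: 'a assume i: "i \<in> Basis"
      have "\<bar>y \<bullet> i - fst S \<bullet> i\<bar> < side S / 2" "\<bar>z \<bullet> i - fst S \<bullet> i\<bar> < 5 * side S / 2"
        using that i by (auto simp: ocube_def dil_def side_def)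
      then show "\<bar>(y - z) \<bullet> i\<bar> \<le> 3 * side P"
        using that(3) unfolding inner_diff_left by linarith
    qed
    then show ?thesis by (simp add: mult_ac)
  qed
  have sub': "ocube P' \<subseteq> ocube (dil 5 P')" using P' by (intro ocube_subset_dil) auto
  have "ennreal (\<bar>f x - f x'\<bar> powr q) * ennreal (side P' powr ?d) = (\<integral>\<^sup>+z\<in>ocube P'. ennreal (\<bar>f x - f x'\<bar> powr q) \<partial>lebesgue)"
    using emeasure_ocube[OF P'(1)] by (simp add: nn_integral_cmult_indicator del: emeasure_completion)
  also have "\<dots> \<le> (\<integral>\<^sup>+z\<in>ocube P'. ennreal B * (?k x z + ?k x' z) \<partial>lebesgue)"
  proof (intro nn_integral_mono)
    fix z
    show "ennreal (\<bar>f x - f x'\<bar> powr q) * indicator (ocube P') z \<le> ennreal B * (?k x z + ?k x' z) * indicator (ocube P') z"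
    proof (cases "z \<in> ocube P'")
      case True
      have "\<bar>f x - f x'\<bar> powr q \<le> (\<bar>f x - f z\<bar> + \<bar>f x' - f z\<bar>) powr q"
        using q by (intro powr_mono2) auto
      also have "\<dots> \<le> 2 powr q * (\<bar>f x - f z\<bar> powr q + \<bar>f x' - f z\<bar> powr q)"
        using q by (intro powr_add2_le) auto
      finally have "ennreal (\<bar>f x - f x'\<bar> powr q) \<le> ennreal (2 powr q) * (ennreal (\<bar>f x - f z\<bar> powr q) + ennreal (\<bar>f x' - f z\<bar> powr q))"
        by (simp flip: ennreal_mult ennreal_plus)
      also have "\<dots> \<le> ennreal (2 powr q) * (ennreal ((3 * ?d * side P) powr (s * q + ?d)) * ?k x z
          + ennreal ((3 * ?d * side P) powr (s * q + ?d)) * ?k x' z)"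
        using True sub sub' x x' q s P'
        by (intro mult_left_mono add_mono diff_powr_le_kernel near[of x P z] near[of x' P' z]) auto
      also have "\<dots> = ennreal B * (?k x z + ?k x' z)"
        by (simp only: B_def ennreal_mult powr_ge_zero distrib_left mult.assoc)
      finally show ?thesis using True by simp
    qed simp
  qed
  also have "\<dots> = ennreal B * (\<integral>\<^sup>+z. ?k x z * indicator (ocube P') z + ?k x' z * indicator (ocube P') z \<partial>lebesgue)"
    by (subst nn_integral_cmult[symmetric]) (auto simp: distrib_right mult.assoc)
  also have "\<dots> = ennreal B * (inner_int f s q (ocube P') x + inner_int f s q (ocube P') x')"
    unfolding inner_int_def by (subst nn_integral_add) auto
  also have "\<dots> \<le> ennreal B * ?X"
    using sub sub' by (intro mult_left_mono add_mono inner_int_mono) auto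
  finally have main: "ennreal (\<bar>f x - f x'\<bar> powr q) * ennreal (side P' powr ?d) \<le> ennreal B * ?X" .
  have "ennreal (\<bar>f x - f x'\<bar> powr q) = ennreal (side P' powr - ?d) * (ennreal (\<bar>f x - f x'\<bar> powr q) * ennreal (side P' powr ?d))"
    using P' by (simp add: powr_minus flip: ennreal_mult)
  also have "\<dots> \<le> ennreal (side P' powr - ?d) * (ennreal B * ?X)"
    using main by (rule mult_left_mono) simp
  also have "\<dots> = ennreal (side P' powr - ?d * B) * ?X"
    by (simp add: ennreal_mult B_def mult.assoc)
  also have "\<dots> \<le> ennreal (local_const ?d s q * side P powr (s * q)) * ?X"
  proof (intro mult_right_mono ennreal_leI)
    have "side P' powr - ?d * B \<le> (side P / 2) powr - ?d * B"
      using P' by (intro mult_right_mono powr_mono2') (auto simp: B_def)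
    also have "(side P / 2) powr - ?d = 2 powr ?d * side P powr - ?d"
      using P' by (simp add: powr_divide powr_minus_divide)
    also have Beq: "B = 2 powr q * (3 * ?d) powr (s * q + ?d) * (side P powr (s * q) * side P powr ?d)"
      using P' by (simp add: B_def powr_mult powr_add)
    also have "2 powr ?d * side P powr - ?d * (2 powr q * (3 * ?d) powr (s * q + ?d) * (side P powr (s * q) * side P powr ?d))
       = local_const ?d s q * side P powr (s * q) * (side P powr - ?d * side P powr ?d)"
      by (simp add: local_const_def mult_ac)
    also have "side P powr - ?d * side P powr ?d = 1"
      using P' by (simp flip: powr_add)
    finally show "side P' powr - ?d * B \<le> local_const ?d s q * side P powr (s * q)"
      by (simp add: Beq)
  qed simp
  finally show ?thesis .
qed

subsection \<open>The estimate over finite families\<close>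

text \<open>The leading 1 is for the part inside 5Q. The common factor collects the distance
  comparison and the three-term splitting. In the bracket: the oscillation in \<open>Q\<close>,
  through the integral at \<open>x\<close> and then through \<open>h Q\<close>; the chain; the
  oscillation in \<open>S\<close>.\<close>

definition pointwise_const :: "real \<Rightarrow> real \<Rightarrow> real \<Rightarrow> real \<Rightarrow> real \<Rightarrow> real" where
  "pointwise_const d s q C e = 1 + ((d + 2)^2) powr (s * q + d) * 3 powr q *
     (local_const d s q * gap_const d (s * q)
      + (local_const d s q * gap_const d (s * q) * 2 powr (s + d)
         + 2 * 2 powr (s * q) * local_const d s q * chain_const d s q C e
         + 2 * local_const d s q))"

lemma local_const_nonneg: "0 \<le> local_const d s q"
  by (simp add: local_const_def)

lemma chain_const_nonneg: "0 < s \<Longrightarrow> 0 \<le> chain_const d s q C e"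
  by (simp add: chain_const_def gap_const_nonneg)

lemma pointwise_const_ge_1:
  assumes "0 < s" "0 < q" shows "1 \<le> pointwise_const d s q C e"
  using assms by (simp add: pointwise_const_def local_const_nonneg chain_const_nonneg gap_const_nonneg)

text \<open>Only the smaller neighbor is known to lie in the dilate of the other, so the bound is
  proved for \<open>side S \<le> side P\<close> and then symmetrised. Since
  \<open>side P \<le> 2 * side S\<close>, each mean can be paired with its own side at the cost of
  2^(s * q).\<close>

lemma neighbor_value_difference_le:
  fixes f :: "'a::euclidean_space \<Rightarrow> real"
  assumes f: "f \<in> borel_measurable lebesgue" and s: "0 < s" and q: "1 \<le> q"
    and PS: "P \<in> U" "S \<in> U" "neighbors P S"
    and pos: "\<And>P. P \<in> U \<Longrightarrow> 0 < side P" and sub: "\<And>P. P \<in> U \<Longrightarrow> ocube P \<subseteq> \<Omega>"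
    and whit: "\<And>P S. P \<in> U \<Longrightarrow> S \<in> U \<Longrightarrow> ocube S \<subseteq> ocube (dil 5 P) \<Longrightarrow> side P / 2 \<le> side S"
    and xp: "\<And>P. P \<in> U \<Longrightarrow> xp P \<in> ocube P" and h: "\<And>P. P \<in> U \<Longrightarrow> 0 \<le> h P"
    and le: "\<And>P. P \<in> U \<Longrightarrow> inner_int f s q (ocube (dil 5 P) \<inter> \<Omega>) (xp P) \<le> ennreal (h P)"
  shows "\<bar>f (xp P) - f (xp S)\<bar> \<le> (2 * 2 powr (s * q) * local_const (real DIM('a)) s q) powr (1 / q) * (side P powr s * h P powr (1 / q))
      + (2 * 2 powr (s * q) * local_const (real DIM('a)) s q) powr (1 / q) * (side S powr s * h S powr (1 / q))"
proof -
  let ?lc = "local_const (real DIM('a)) s q" and ?u = "\<lambda>P. side P powr s * h P powr (1 / q)"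
  have larger: "\<bar>f (xp P) - f (xp S)\<bar> powr q \<le> ?lc * side P powr (s * q) * (h P + h S) \<and> side P \<le> 2 * side S"
    if PS: "P \<in> U" "S \<in> U" "neighbors P S" "side S \<le> side P" for P S
  proof
    have subd: "ocube S \<subseteq> ocube (dil 5 P)"
      using PS pos by (intro neighbor_subset_dil) auto
    then show le2: "side P \<le> 2 * side S" using whit[OF PS(1,2)] by simp
    have "ennreal (\<bar>f (xp P) - f (xp S)\<bar> powr q) \<le> ennreal (?lc * side P powr (s * q))
       * (inner_int f s q (ocube (dil 5 P) \<inter> \<Omega>) (xp P) + inner_int f s q (ocube (dil 5 S) \<inter> \<Omega>) (xp S))"
      using PS pos subd le2 sub xp by (intro local_oscillation_le f s q) auto
    also have "\<dots> \<le> ennreal (?lc * side P powr (s * q)) * (ennreal (h P) + ennreal (h S))"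
      using PS le by (intro mult_left_mono add_mono) auto
    also have "\<dots> = ennreal (?lc * side P powr (s * q) * (h P + h S))"
      using h PS by (simp add: local_const_nonneg ennreal_mult)
    finally show "\<bar>f (xp P) - f (xp S)\<bar> powr q \<le> ?lc * side P powr (s * q) * (h P + h S)"
      using h PS by (subst (asm) ennreal_le_iff) (auto simp: local_const_nonneg)
  qed
  have uq: "?u P powr q = side P powr (s * q) * h P" if "P \<in> U" for P
    using h[OF that] q by (simp add: powr_mult powr_powr)
  have main: "\<bar>f (xp P) - f (xp S)\<bar> powr q \<le> 2 powr (s * q) * ?lc * (?u P powr q + ?u S powr q)"
    if PS: "P \<in> U" "S \<in> U" "neighbors P S" "side S \<le> side P" for P S
  proof -
    have l: "\<bar>f (xp P) - f (xp S)\<bar> powr q \<le> ?lc * side P powr (s * q) * (h P + h S)" "side P \<le> 2 * side S"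
      using larger[OF PS] by auto
    have pP: "0 < side P" and pS: "0 < side S" using pos PS by auto
    have "side P powr (s * q) \<le> (2 * side S) powr (s * q)"
      using l s q pP by (intro powr_mono2) auto
    then have a: "side P powr (s * q) \<le> 2 powr (s * q) * side S powr (s * q)"
      using pS by (simp add: powr_mult)
    have b: "side P powr (s * q) \<le> 2 powr (s * q) * side P powr (s * q)"
      using mult_right_mono[OF ge_one_powr_ge_zero[of 2 "s * q"], of "side P powr (s * q)"] s q by simp
    have "side P powr (s * q) * (h P + h S) \<le> 2 powr (s * q) * side P powr (s * q) * h P + 2 powr (s * q) * side S powr (s * q) * h S"
      unfolding distrib_left using a b h PS by (intro add_mono mult_right_mono) auto
    then have "?lc * (side P powr (s * q) * (h P + h S)) \<le> ?lc * (2 powr (s * q) * side P powr (s * q) * h P + 2 powr (s * q) * side S powr (s * q) * h S)"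
      by (intro mult_left_mono local_const_nonneg)
    then show ?thesis
      using l(1) unfolding uq[OF PS(1)] uq[OF PS(2)] by (simp add: algebra_simps)
  qed
  have sym: "\<bar>f (xp P) - f (xp S)\<bar> powr q \<le> 2 powr (s * q) * ?lc * (?u P powr q + ?u S powr q)"
  proof (cases "side S \<le> side P")
    case False
    then show ?thesis
      using main[of S P] PS by (simp add: neighbors_commute abs_minus_commute add.commute)
  qed (use main PS in blast)
  \<comment> \<open>Written as one q-th power, so that the q-th root gives the additive form
    required for summing along a chain.\<close>
  also have "\<dots> \<le> 2 powr (s * q) * ?lc * (2 * (?u P + ?u S) powr q)"
  proof (intro mult_left_mono)
    have "?u P powr q \<le> (?u P + ?u S) powr q" "?u S powr q \<le> (?u P + ?u S) powr q"
      using q by (auto intro!: powr_mono2)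
    then show "?u P powr q + ?u S powr q \<le> 2 * (?u P + ?u S) powr q" by linarith
  qed (simp add: local_const_nonneg)
  finally have "\<bar>f (xp P) - f (xp S)\<bar> powr q \<le> (2 * 2 powr (s * q) * ?lc) * (?u P + ?u S) powr q"
    by (simp add: mult_ac)
  then have "(\<bar>f (xp P) - f (xp S)\<bar> powr q) powr (1 / q) \<le> ((2 * 2 powr (s * q) * ?lc) * (?u P + ?u S) powr q) powr (1 / q)"
    using q by (intro powr_mono2) auto
  also have "\<dots> = (2 * 2 powr (s * q) * ?lc) powr (1 / q) * (?u P + ?u S)"
  proof -
    have "((?u P + ?u S) powr q) powr (1 / q) = ?u P + ?u S"
      using q by (simp add: powr_powr)
    then show ?thesis
      by (subst powr_mult) (auto simp: local_const_nonneg)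
  qed
  finally show ?thesis
    using q by (simp add: powr_powr distrib_left)
qed

text \<open>The pointwise estimate behind the theorem. The constant is independent of
  \<open>U\<close>, \<open>V\<close>, \<open>x\<close> and the chosen points.\<close>

lemma inner_int_union_le:
  fixes f :: "'a::euclidean_space \<Rightarrow> real"
  assumes f: "f \<in> borel_measurable lebesgue" and s: "0 < s" and q: "1 \<le> q" and C: "0 < C" and e: "0 < e"
    and dc: "disjoint_cubes U" and VU: "V \<subseteq> U" and Q: "Q \<in> U" and x: "x \<in> ocube Q"
    and \<Omega>: "\<Omega> \<in> sets lebesgue" and sub: "\<And>P. P \<in> U \<Longrightarrow> ocube P \<subseteq> \<Omega>"
    and whit: "\<And>P S. P \<in> U \<Longrightarrow> S \<in> U \<Longrightarrow> ocube S \<subseteq> ocube (dil 5 P) \<Longrightarrow> side P / 2 \<le> side S"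
    and xp: "\<And>P. P \<in> U \<Longrightarrow> xp P \<in> ocube P" and h: "\<And>P. P \<in> U \<Longrightarrow> 0 \<le> h P"
    and le: "\<And>P. P \<in> U \<Longrightarrow> inner_int f s q (ocube (dil 5 P) \<inter> \<Omega>) (xp P) \<le> ennreal (h P)"
    and mean: "\<And>P. P \<in> U \<Longrightarrow> (\<integral>\<^sup>+y\<in>ocube P. inner_int f s q (ocube (dil 5 P) \<inter> \<Omega>) y \<partial>lebesgue)
        = ennreal (h P * side P powr real DIM('a))"
    and link: "\<And>S. S \<in> V \<Longrightarrow> \<exists>ch. is_chain U ch Q S \<and> set ch \<subseteq> linking_cubes U C e Q S"
  shows "inner_int f s q (\<Union>S\<in>V. ocube S) x \<le> ennreal (pointwise_const (real DIM('a)) s q C e)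
      * (inner_int f s q (ocube (dil 5 Q) \<inter> \<Omega>) x + ennreal (\<Sum>P\<in>U. gap_kernel s Q P * h P))"
proof (cases "inner_int f s q (ocube (dil 5 Q) \<inter> \<Omega>) x")
  \<comment> \<open>The constant is at least 1, so the right side is infinite too.\<close>
  case top
  then show ?thesis
    using pointwise_const_ge_1[OF s, of q "real DIM('a)" C e] q by (simp add: ennreal_mult_top)
next
  case (real t0)
  let ?d = "real DIM('a)"
  let ?t = "s * q + ?d" and ?F = "\<lambda>P. inner_int f s q (ocube (dil 5 P) \<inter> \<Omega>)"
  let ?k = "\<lambda>y. ennreal (\<bar>f x - f y\<bar> powr q / norm (x - y) powr (s * q + real DIM('a)))"
  let ?E = "\<lambda>S. ocube S - ocube (dil 5 Q)"
  define lc where "lc = local_const ?d s q"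
  define gc where "gc = gap_const ?d (s * q)"
  define cc where "cc = chain_const ?d s q C e"
  define D where "D = ((?d + 2)^2) powr ?t * 3 powr q"
  define X where "X = (\<lambda>S. side S powr ?d * cube_gap Q S powr (- (s * q) - ?d))"
  define c where "c = (\<lambda>S. \<bar>f (xp Q) - f (xp S)\<bar> powr q)"
  define a where "a = lc * side Q powr (s * q) * (t0 + h Q)"
  define T where "T = (\<Sum>P\<in>U. gap_kernel s Q P * h P)"
  have pos: "\<And>S. S \<in> U \<Longrightarrow> 0 < side S" and U: "finite U"
    using dc by (auto simp: disjoint_cubes_def)
  have V: "finite V" using VU U by (rule finite_subset)
  then have dcV: "disjoint_cubes V"
    using dc VU unfolding disjoint_cubes_def by blast
  have sq: "0 < s * q" using s q by simp
  have lc0: "0 \<le> lc" and gc0: "0 \<le> gc" and cc0: "0 \<le> cc" and D0: "0 \<le> D"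
    using sq s by (simp_all add: lc_def gc_def cc_def D_def local_const_nonneg gap_const_nonneg chain_const_nonneg)
  have t0: "0 \<le> t0" "?F Q x = ennreal t0" using real by auto
  have a0: "0 \<le> a" using lc0 t0 h[OF Q] by (simp add: a_def)
  have X0: "0 \<le> X S" for S by (simp add: X_def)
  have km [measurable]: "?k \<in> borel_measurable lebesgue"
    by (rule kernel_measurable[OF f])
  have Fm [measurable]: "?F S \<in> borel_measurable lebesgue" for S
    using \<Omega> by (intro inner_int_measurable f) auto
  \<comment> \<open>The local estimate with both cubes equal to \<open>S\<close>.\<close>
  have osc: "ennreal (\<bar>f y - f (xp S)\<bar> powr q) \<le> ennreal (lc * side S powr (s * q)) * (?F S y + ennreal (h S))"
    if S: "S \<in> U" and y: "y \<in> ocube S" for S y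
  proof -
    have "ennreal (\<bar>f y - f (xp S)\<bar> powr q) \<le> ennreal (lc * side S powr (s * q)) * (?F S y + ?F S (xp S))"
      unfolding lc_def using pos[OF S] sub[OF S] y xp[OF S]
      by (intro local_oscillation_le f s q ocube_subset_dil) auto
    also have "\<dots> \<le> ennreal (lc * side S powr (s * q)) * (?F S y + ennreal (h S))"
      by (intro mult_left_mono add_mono le S) auto
    finally show ?thesis .
  qed
  have osc_x: "\<bar>f x - f (xp Q)\<bar> powr q \<le> a"
  proof -
    have "ennreal (\<bar>f x - f (xp Q)\<bar> powr q) \<le> ennreal a"
      using osc[OF Q x] t0 h[OF Q] lc0 unfolding a_def by (simp add: ennreal_mult)
    then show ?thesis using a0 by simp
  qed
  have far: "(\<integral>\<^sup>+y\<in>?E S. ?k y \<partial>lebesgue) \<le> ennreal (D * X S * (a + c S + 2 * (lc * side S powr (s * q) * h S)))"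
    if S: "S \<in> V" for S
  proof -
    have SU: "S \<in> U" using S VU by auto
    define G where "G = D * cube_gap Q S powr (- (s * q) - ?d)"
    define b where "b = lc * side S powr (s * q)"
    have G0: "0 \<le> G" and b0: "0 \<le> b" using D0 lc0 by (simp_all add: G_def b_def)
    have c0: "0 \<le> c S" by (simp add: c_def)
    have pt: "?k y * indicator (?E S) y
        \<le> ennreal (G * (a + c S + b * h S)) * indicator (ocube S) y + ennreal (G * b) * (?F S y * indicator (ocube S) y)" for y
    proof (cases "y \<in> ?E S")
      case True
      have "cube_gap Q S \<le> (?d + 2)^2 * norm (x - y)"
        using True x pos Q SU whit by (intro cube_gap_le_norm) auto
      then have gn: "cube_gap Q S / (?d + 2)^2 \<le> norm (x - y)"
        by (simp add: field_simps add_pos_nonneg)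
      have gp: "0 < cube_gap Q S" using pos Q SU by (simp add: cube_gap_pos)
      have tt: "- (s * q) - ?d = - ?t" by simp
      have "norm (x - y) powr - ?t \<le> (cube_gap Q S / (?d + 2)^2) powr - ?t"
        using gn gp sq by (intro powr_mono2') (auto simp: add_pos_nonneg)
      also have "\<dots> = ((?d + 2)^2) powr ?t * cube_gap Q S powr (- (s * q) - ?d)"
        unfolding tt using gp
        by (simp only: powr_divide less_imp_le zero_le_power2)
          (simp only: powr_minus divide_inverse inverse_inverse_eq mult.commute)
      finally have nt: "norm (x - y) powr - ?t \<le> ((?d + 2)^2) powr ?t * cube_gap Q S powr (- (s * q) - ?d)" .
      have "\<bar>f x - f y\<bar> powr q \<le> (\<bar>f x - f (xp Q)\<bar> + \<bar>f (xp Q) - f (xp S)\<bar> + \<bar>f y - f (xp S)\<bar>) powr q"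
        using q by (intro powr_mono2) auto
      also have "\<dots> \<le> 3 powr q * (\<bar>f x - f (xp Q)\<bar> powr q + \<bar>f (xp Q) - f (xp S)\<bar> powr q + \<bar>f y - f (xp S)\<bar> powr q)"
        using q by (intro powr_add3_le) auto
      also have "\<dots> \<le> 3 powr q * (a + c S + \<bar>f y - f (xp S)\<bar> powr q)"
        using osc_x by (intro mult_left_mono add_mono) (auto simp: c_def)
      finally have "\<bar>f x - f y\<bar> powr q * norm (x - y) powr - ?t
          \<le> (3 powr q * (a + c S + \<bar>f y - f (xp S)\<bar> powr q)) * (((?d + 2)^2) powr ?t * cube_gap Q S powr (- (s * q) - ?d))"
        using nt a0 c0 by (intro mult_mono) auto
      also have "\<dots> = G * (a + c S + \<bar>f y - f (xp S)\<bar> powr q)"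
        by (simp only: G_def D_def mult_ac)
      finally have "\<bar>f x - f y\<bar> powr q / norm (x - y) powr ?t \<le> G * (a + c S + \<bar>f y - f (xp S)\<bar> powr q)"
        by (simp only: powr_minus divide_inverse)
      then have "?k y \<le> ennreal (G * (a + c S + \<bar>f y - f (xp S)\<bar> powr q))"
        by (rule ennreal_leI)
      also have "\<dots> = ennreal (G * (a + c S)) + ennreal G * ennreal (\<bar>f y - f (xp S)\<bar> powr q)"
        using G0 a0 c0 by (simp add: distrib_left flip: ennreal_mult ennreal_plus)
      also have "\<dots> \<le> ennreal (G * (a + c S)) + ennreal G * (ennreal b * (?F S y + ennreal (h S)))"
        unfolding b_def using True by (intro add_left_mono mult_left_mono osc SU) auto
      also have "\<dots> = ennreal (G * (a + c S)) + ennreal (G * b * h S) + ennreal (G * b) * ?F S y"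
        using G0 b0 h[OF SU] by (simp add: distrib_left ennreal_mult mult.assoc add_ac)
      also have "ennreal (G * (a + c S)) + ennreal (G * b * h S) = ennreal (G * (a + c S + b * h S))"
        using G0 b0 h[OF SU] a0 c0 by (simp add: distrib_left mult.assoc flip: ennreal_plus)
      finally show ?thesis using True by simp
    qed simp
    have "(\<integral>\<^sup>+y\<in>?E S. ?k y \<partial>lebesgue) \<le> (\<integral>\<^sup>+y. ennreal (G * (a + c S + b * h S)) * indicator (ocube S) y
        + ennreal (G * b) * (?F S y * indicator (ocube S) y) \<partial>lebesgue)"
      using pt by (rule nn_integral_mono)
    also have "\<dots> = ennreal (G * (a + c S + b * h S)) * ennreal (side S powr ?d) + ennreal (G * b) * ennreal (h S * side S powr ?d)"
      by (subst nn_integral_add) (auto simp: nn_integral_cmult nn_integral_cmult_indicator mean[OF SU]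
            emeasure_ocube[OF pos[OF SU]] simp del: emeasure_completion)
    also have "\<dots> = ennreal (G * (a + c S + b * h S) * side S powr ?d + G * b * (h S * side S powr ?d))"
      using G0 b0 h[OF SU] a0 c0 by (simp flip: ennreal_mult ennreal_plus)
    \<comment> \<open>The factor 2 appears because \<open>h S\<close> enters twice: as the bound at
      \<open>xp S\<close>, and as the mean of the local integral over \<open>y\<close>.\<close>
    also have "G * (a + c S + b * h S) * side S powr ?d + G * b * (h S * side S powr ?d)
        = D * X S * (a + c S + 2 * (lc * side S powr (s * q) * h S))"
      by (simp add: G_def X_def b_def algebra_simps)
    finally show ?thesis .
  qed
  have "inner_int f s q (\<Union>S\<in>V. ocube S) x \<le> (\<integral>\<^sup>+y. ?k y * indicator (ocube (dil 5 Q) \<inter> \<Omega>) y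
      + (\<Sum>S\<in>V. ?k y * indicator (?E S) y) \<partial>lebesgue)"
    unfolding inner_int_def
  proof (intro nn_integral_mono)
    fix y
    show "?k y * indicator (\<Union>S\<in>V. ocube S) y
        \<le> ?k y * indicator (ocube (dil 5 Q) \<inter> \<Omega>) y + (\<Sum>S\<in>V. ?k y * indicator (?E S) y)"
    proof (cases "y \<in> (\<Union>S\<in>V. ocube S)")
      case True
      then obtain S where S: "S \<in> V" "y \<in> ocube S" by auto
      show ?thesis
      proof (cases "y \<in> ocube (dil 5 Q)")
        case True
        moreover have "y \<in> \<Omega>" using S(2) sub[OF subsetD[OF VU S(1)]] by auto
        ultimately show ?thesis by (simp add: add_increasing2 indicator_def)
      next
        case False
        then have "?k y * indicator (\<Union>S\<in>V. ocube S) y \<le> ?k y * indicator (?E S) y"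
          using S by (simp add: indicator_def)
        also have "\<dots> \<le> (\<Sum>S\<in>V. ?k y * indicator (?E S) y)"
          using S V by (intro member_le_sum) auto
        finally show ?thesis by (rule order_trans) simp
      qed
    qed simp
  qed
  also have "\<dots> = ?F Q x + (\<Sum>S\<in>V. \<integral>\<^sup>+y\<in>?E S. ?k y \<partial>lebesgue)"
    unfolding inner_int_def using \<Omega>
    by (subst nn_integral_add) (auto simp: nn_integral_sum intro!: borel_measurable_sum)
  also have "\<dots> \<le> ennreal t0 + (\<Sum>S\<in>V. ennreal (D * X S * (a + c S + 2 * (lc * side S powr (s * q) * h S))))"
    unfolding t0(2) using far by (intro add_left_mono sum_mono) auto
  also have "\<dots> = ennreal (t0 + (\<Sum>S\<in>V. D * X S * (a + c S + 2 * (lc * side S powr (s * q) * h S))))"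
  proof -
    have nn: "0 \<le> D * X S * (a + c S + 2 * (lc * side S powr (s * q) * h S))" if "S \<in> V" for S
      using D0 X0 a0 lc0 h[OF subsetD[OF VU that]] by (simp add: c_def)
    then show ?thesis using t0(1) by (simp add: sum_ennreal sum_nonneg)
  qed
  also have "\<dots> \<le> ennreal (pointwise_const ?d s q C e * (t0 + T))"
  proof (rule ennreal_leI)
    have sumX: "(\<Sum>S\<in>V. X S) \<le> gc * side Q powr - (s * q)"
      unfolding X_def gc_def by (rule sum_gap_all_le[OF dcV pos[OF Q] sq])
    have T0: "0 \<le> T" unfolding T_def using h by (intro sum_nonneg mult_nonneg_nonneg gap_kernel_nonneg) auto
    \<comment> \<open>The diagonal term: \<open>cube_gap Q Q\<close> is twice
      \<open>side Q\<close>.\<close>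
    have hQ: "h Q \<le> 2 powr (s + ?d) * T"
    proof -
      have "gap_kernel s Q Q = (1 / 2) powr (s + ?d)"
        using pos[OF Q] by (simp add: gap_kernel_def cube_gap_def)
      also have "\<dots> = 1 / 2 powr (s + ?d)" by (simp add: powr_divide)
      finally have "h Q = 2 powr (s + ?d) * (gap_kernel s Q Q * h Q)" by simp
      also have "gap_kernel s Q Q * h Q \<le> T"
        unfolding T_def using U Q h by (intro member_le_sum mult_nonneg_nonneg gap_kernel_nonneg) auto
      finally show ?thesis by simp
    qed
    \<comment> \<open>The powers of \<open>side Q\<close> in the oscillation and in the full sum of
      \<open>X\<close> cancel.\<close>
    have "a * (\<Sum>S\<in>V. X S) \<le> a * (gc * side Q powr - (s * q))"
      using sumX a0 by (rule mult_left_mono)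
    also have "\<dots> = lc * gc * (t0 + h Q)"
    proof -
      have "side Q powr (s * q) * side Q powr - (s * q) = 1"
        using pos[OF Q] by (simp flip: powr_add)
      then show ?thesis by (simp add: a_def)
    qed
    also have "\<dots> \<le> lc * gc * (t0 + 2 powr (s + ?d) * T)"
      using hQ lc0 gc0 by (intro mult_left_mono add_left_mono) auto
    finally have p1: "a * (\<Sum>S\<in>V. X S) \<le> lc * gc * (t0 + 2 powr (s + ?d) * T)" .
    have p2: "(\<Sum>S\<in>V. X S * c S) \<le> 2 * 2 powr (s * q) * lc * cc * T"
    proof -
      have "(\<Sum>S\<in>V. X S * c S) \<le> ((2 * 2 powr (s * q) * lc) powr (1 / q)) powr q * cc * T"
        unfolding X_def c_def cc_def T_def
      proof (rule sum_chain_differences_le[where \<phi> = "\<lambda>P. f (xp P)"])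
        show "\<bar>f (xp P) - f (xp S)\<bar> \<le> (2 * 2 powr (s * q) * lc) powr (1 / q) * (side P powr s * h P powr (1 / q))
            + (2 * 2 powr (s * q) * lc) powr (1 / q) * (side S powr s * h S powr (1 / q))"
          if "P \<in> U" "S \<in> U" "neighbors P S" for P S
          unfolding lc_def
          by (rule neighbor_value_difference_le[where U = U and \<Omega> = \<Omega>, OF f s q that]) (fact pos sub whit xp h le)+
      qed (use dc VU Q h s q C e link in auto)
      then show ?thesis using q lc0 by (simp add: powr_powr)
    qed
    have p3: "(\<Sum>S\<in>V. X S * (lc * side S powr (s * q) * h S)) \<le> lc * T"
    proof -
      have "(\<Sum>S\<in>V. X S * (lc * side S powr (s * q) * h S)) \<le> (\<Sum>S\<in>V. lc * (gap_kernel s Q S * h S))"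
      proof (intro sum_mono)
        fix S assume "S \<in> V"
        then have SU: "S \<in> U" using VU by auto
        have "X S * side S powr (s * q) = gap_kernel (s * q) Q S"
          using gap_kernel_eq[OF pos[OF Q] pos[OF SU]] by (simp add: X_def mult_ac)
        also have "\<dots> \<le> gap_kernel s Q S"
          unfolding gap_kernel_def
        \<comment> \<open>The ratio is at most 1, so the larger exponent s * q + d gives the smaller
          kernel; this uses q \<ge> 1.\<close>
        proof (rule powr_mono')
          show "s + ?d \<le> s * q + ?d" using s q by simp
          show "side S / cube_gap Q S \<le> 1"
            using side_le_cube_gap(2)[of Q S] pos[OF Q] pos[OF SU] cube_gap_pos[of Q S] by simp
          show "0 \<le> side S / cube_gap Q S"
            using pos[OF SU] cube_gap_pos[OF pos[OF Q] pos[OF SU]] by simp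
        qed
        finally have "lc * (X S * side S powr (s * q) * h S) \<le> lc * (gap_kernel s Q S * h S)"
          using lc0 h[OF SU] by (intro mult_left_mono mult_right_mono) auto
        then show "X S * (lc * side S powr (s * q) * h S) \<le> lc * (gap_kernel s Q S * h S)"
          by (simp add: mult_ac)
      qed
      also have "\<dots> \<le> lc * T"
        unfolding T_def sum_distrib_left using U VU h lc0
        by (intro sum_mono2 mult_nonneg_nonneg gap_kernel_nonneg) auto
      finally show ?thesis .
    qed
    have "(\<Sum>S\<in>V. D * X S * (a + c S + 2 * (lc * side S powr (s * q) * h S)))
       = D * (a * (\<Sum>S\<in>V. X S) + (\<Sum>S\<in>V. X S * c S) + 2 * (\<Sum>S\<in>V. X S * (lc * side S powr (s * q) * h S)))"
      by (simp add: sum_distrib_left sum.distrib[symmetric] algebra_simps)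
    also have "\<dots> \<le> D * (lc * gc * (t0 + 2 powr (s + ?d) * T) + 2 * 2 powr (s * q) * lc * cc * T + 2 * (lc * T))"
      using p1 p2 p3 D0 by (intro mult_left_mono add_mono) auto
    also have "\<dots> = D * (lc * gc) * t0 + D * (lc * gc * 2 powr (s + ?d) + 2 * 2 powr (s * q) * lc * cc + 2 * lc) * T"
      by (simp add: algebra_simps)
    finally have main: "t0 + (\<Sum>S\<in>V. D * X S * (a + c S + 2 * (lc * side S powr (s * q) * h S)))
       \<le> t0 + D * (lc * gc) * t0 + D * (lc * gc * 2 powr (s + ?d) + 2 * 2 powr (s * q) * lc * cc + 2 * lc) * T"
      by simp
    let ?A = "D * (lc * gc)" and ?B = "D * (lc * gc * 2 powr (s + ?d) + 2 * 2 powr (s * q) * lc * cc + 2 * lc)"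
    have AB: "0 \<le> ?A" "0 \<le> ?B" using D0 lc0 gc0 cc0 by simp_all
    have "pointwise_const ?d s q C e = 1 + ?A + ?B"
      by (simp add: pointwise_const_def D_def lc_def gc_def cc_def distrib_left)
    then have "pointwise_const ?d s q C e * (t0 + T) = (t0 + ?A * t0 + ?B * T) + (T + ?A * T + ?B * t0)"
      by (simp add: algebra_simps)
    moreover have "0 \<le> T + ?A * T + ?B * t0" using AB T0 t0 by simp
    ultimately show "t0 + (\<Sum>S\<in>V. D * X S * (a + c S + 2 * (lc * side S powr (s * q) * h S))) \<le> pointwise_const ?d s q C e * (t0 + T)"
      using main by linarith
  qed
  also have "\<dots> = ennreal (pointwise_const ?d s q C e) * (ennreal t0 + ennreal T)"
  proof -
    have "0 \<le> T" unfolding T_def using h by (intro sum_nonneg mult_nonneg_nonneg gap_kernel_nonneg) auto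
    moreover have "0 \<le> pointwise_const ?d s q C e"
      using pointwise_const_ge_1[OF s, of q ?d C e] q by simp
    ultimately show ?thesis using t0(1) by (simp add: ennreal_mult)
  qed
  finally show ?thesis by (simp add: t0(2) T_def)
qed

definition finite_union_const :: "real \<Rightarrow> real \<Rightarrow> real \<Rightarrow> real \<Rightarrow> real \<Rightarrow> real \<Rightarrow> real" where
  "finite_union_const d s q r C e = (2 * pointwise_const d s q C e) powr r *
     (1 + (2 * (r * (2 powr (s + d)) powr (r - 1) * gap_const d s)) powr r)"

lemma sum_le_nn_integral_count_space:
  fixes g :: "'i \<Rightarrow> ennreal"
  assumes "finite U" "U \<subseteq> W"
  shows "sum g U \<le> (\<integral>\<^sup>+Q. g Q \<partial>count_space W)"
proof -
  have "sum g U = (\<integral>\<^sup>+Q. (if Q \<in> U then g Q else 0) \<partial>count_space W)"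
    using assms by (subst nn_integral_count_space'[of U]) auto
  also have "\<dots> \<le> (\<integral>\<^sup>+Q. g Q \<partial>count_space W)"
    by (intro nn_integral_mono) auto
  finally show ?thesis .
qed

text \<open>The constant does not see \<open>V\<close> or the auxiliary \<open>U\<close>, and this
  uniformity is what the limit uses. A finite right-hand side supplies a real mean and a
  representative point in every cube; an infinite one is trivial.\<close>

lemma finite_union_double_integral_le:
  fixes f :: "'a::euclidean_space \<Rightarrow> real" and W :: "('a \<times> real) set"
  assumes f: "f \<in> borel_measurable lebesgue" and s: "0 < s" and q: "1 \<le> q" "q \<le> p" and C: "0 < C" and e: "0 < e"
    and \<Omega>: "\<Omega> \<in> sets lebesgue"
    and pos: "\<And>P. P \<in> W \<Longrightarrow> 0 < side P"
    and disj: "\<And>P S. P \<in> W \<Longrightarrow> S \<in> W \<Longrightarrow> P \<noteq> S \<Longrightarrow> ocube P \<inter> ocube S = {}"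
    and sub: "\<And>P. P \<in> W \<Longrightarrow> ocube P \<subseteq> \<Omega>"
    and whit: "\<And>P S. P \<in> W \<Longrightarrow> S \<in> W \<Longrightarrow> ocube S \<subseteq> ocube (dil 5 P) \<Longrightarrow> side P / 2 \<le> side S"
    and link: "\<And>Q S. Q \<in> W \<Longrightarrow> S \<in> W \<Longrightarrow> \<exists>ch. is_chain W ch Q S \<and> set ch \<subseteq> linking_cubes W C e Q S"
    and V: "finite V" "V \<subseteq> W"
  shows "(\<integral>\<^sup>+x\<in>(\<Union>S\<in>V. ocube S). enn_powr (inner_int f s q (\<Union>S\<in>V. ocube S) x) (p / q) \<partial>lebesgue)
     \<le> ennreal (finite_union_const (real DIM('a)) s q (p / q) C e)
       * (\<integral>\<^sup>+Q. (\<integral>\<^sup>+x\<in>ocube Q. enn_powr (inner_int f s q (ocube (dil 5 Q) \<inter> \<Omega>) x) (p / q) \<partial>lebesgue) \<partial>count_space W)"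
proof -
  let ?d = "real DIM('a)" and ?F = "\<lambda>P. inner_int f s q (ocube (dil 5 P) \<inter> \<Omega>)"
  let ?G = "inner_int f s q (\<Union>S\<in>V. ocube S)"
  define r where "r = p / q"
  define I where "I = (\<lambda>Q. \<integral>\<^sup>+x\<in>ocube Q. enn_powr (?F Q x) r \<partial>lebesgue)"
  define K where "K = pointwise_const ?d s q C e"
  define Ko where "Ko = (2 * (r * (2 powr (s + ?d)) powr (r - 1) * gap_const ?d s)) powr r"
  have r: "1 \<le> r" using q by (simp add: r_def)
  have K: "1 \<le> K" unfolding K_def using s q by (intro pointwise_const_ge_1) auto
  have Ko: "0 \<le> Ko" by (simp add: Ko_def)
  have Kf: "finite_union_const ?d s q r C e = (2 * K) powr r * (1 + Ko)"
    by (simp add: finite_union_const_def K_def Ko_def)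
  have Fm [measurable]: "?F P \<in> borel_measurable lebesgue" for P
    using \<Omega> by (intro inner_int_measurable f) auto
  have Gm [measurable]: "?G \<in> borel_measurable lebesgue"
    using V by (intro inner_int_measurable f) auto
  have "(\<integral>\<^sup>+x\<in>(\<Union>S\<in>V. ocube S). enn_powr (?G x) r \<partial>lebesgue)
     \<le> ennreal (finite_union_const ?d s q r C e) * (\<integral>\<^sup>+Q. I Q \<partial>count_space W)"
  proof (cases "(\<integral>\<^sup>+Q. I Q \<partial>count_space W) = top")
    case True
    \<comment> \<open>Positivity matters, since zero times infinity is zero here.\<close>
    have "0 < finite_union_const ?d s q r C e"
      unfolding Kf using K Ko by (intro mult_pos_pos) auto
    then show ?thesis by (simp add: True ennreal_mult_top)
  next
    case False
    have Ifin: "I P < top" if "P \<in> W" for P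
    proof -
      have "I P \<le> (\<integral>\<^sup>+Q. I Q \<partial>count_space W)"
        using sum_le_nn_integral_count_space[of "{P}" W I] that by simp
      also have "\<dots> < top" using False by (simp only: top.not_eq_extremum)
      finally show ?thesis .
    qed
    \<comment> \<open>Mean and point are bundled in one relation because the point depends on the
      mean; a single choice then yields both functions.\<close>
    define R where "R = (\<lambda>P h x. 0 \<le> h \<and> x \<in> ocube P \<and> ?F P x \<le> ennreal h
        \<and> (\<integral>\<^sup>+y\<in>ocube P. ?F P y \<partial>lebesgue) = ennreal (h * side P powr ?d)
        \<and> ennreal (h powr r * side P powr ?d) \<le> I P)"
    have R: "\<exists>h x. R P h x" if P: "P \<in> W" for P
    proof -
      have em: "emeasure lebesgue (ocube P) = ennreal (side P powr ?d)" "0 < side P powr ?d"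
        using emeasure_ocube[OF pos[OF P]] pos[OF P] by auto
      obtain h where h: "0 \<le> h" "(\<integral>\<^sup>+y\<in>ocube P. ?F P y \<partial>lebesgue) = ennreal (h * side P powr ?d)"
        "ennreal (h powr r * side P powr ?d) \<le> I P"
        using nn_integral_mean_powr[OF Fm _ em r, of P] Ifin[OF P] unfolding I_def by auto
      obtain x where "x \<in> ocube P" "?F P x \<le> ennreal h"
        using nn_integral_exists_le_mean[OF Fm _ em h(1,2)] by auto
      then show ?thesis using h unfolding R_def by auto
    qed
    obtain h xp where "\<And>P. P \<in> W \<Longrightarrow> R P (h P) (xp P)"
      using R by metis
    then have hx: "\<And>P. P \<in> W \<Longrightarrow> 0 \<le> h P \<and> xp P \<in> ocube P \<and> ?F P (xp P) \<le> ennreal (h P)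
        \<and> (\<integral>\<^sup>+y\<in>ocube P. ?F P y \<partial>lebesgue) = ennreal (h P * side P powr ?d)
        \<and> ennreal (h P powr r * side P powr ?d) \<le> I P"
      by (simp only: R_def)
    obtain chn where chn: "\<And>Q S. Q \<in> W \<Longrightarrow> S \<in> W \<Longrightarrow> is_chain W (chn Q S) Q S \<and> set (chn Q S) \<subseteq> linking_cubes W C e Q S"
      using link by metis
    \<comment> \<open>The cubes of all chosen chains between members of \<open>V\<close> are
      adjoined; the result is still finite.\<close>
    define U where "U = V \<union> (\<Union>Q\<in>V. \<Union>S\<in>V. set (chn Q S))"
    have U: "finite U" using V by (simp add: U_def)
    have VU: "V \<subseteq> U" by (auto simp: U_def)
    have UW: "U \<subseteq> W"
    proof
      fix P assume "P \<in> U"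
      then consider "P \<in> V" | Q S where "Q \<in> V" "S \<in> V" "P \<in> set (chn Q S)" unfolding U_def by blast
      then show "P \<in> W"
      proof cases
        case 2
        then have "set (chn Q S) \<subseteq> W" using chn[of Q S] V by (auto simp: is_chain_def)
        then show ?thesis using 2 by auto
      qed (use V in auto)
    qed
    have linkU: "\<exists>ch. is_chain U ch Q S \<and> set ch \<subseteq> linking_cubes U C e Q S" if "Q \<in> V" "S \<in> V" for Q S
    proof (intro exI conjI)
      have ch: "is_chain W (chn Q S) Q S" "set (chn Q S) \<subseteq> linking_cubes W C e Q S"
        using chn[OF subsetD[OF V(2) that(1)] subsetD[OF V(2) that(2)]] by blast+
      have sU: "set (chn Q S) \<subseteq> U" using that unfolding U_def by blast
      show "is_chain U (chn Q S) Q S" using ch(1) sU by (simp add: is_chain_def)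
      show "set (chn Q S) \<subseteq> linking_cubes U C e Q S"
        using ch(2) sU unfolding linking_cubes_def by blast
    qed
    have dcU: "disjoint_cubes U"
      unfolding disjoint_cubes_def using U pos[OF subsetD[OF UW]] disj[OF subsetD[OF UW] subsetD[OF UW]] by blast
    have hU: "0 \<le> h P" if "P \<in> U" for P using hx[OF subsetD[OF UW that]] by simp
    define T where "T = (\<lambda>Q. \<Sum>P\<in>U. gap_kernel s Q P * h P)"
    have T0: "0 \<le> T Q" for Q
      unfolding T_def using hU by (intro sum_nonneg mult_nonneg_nonneg gap_kernel_nonneg) auto
    have pt: "enn_powr (?G x) r \<le> ennreal ((2 * K) powr r) * (enn_powr (?F Q x) r + ennreal (T Q powr r))"
      if Q: "Q \<in> V" and x: "x \<in> ocube Q" for Q x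
    proof -
      have "?G x \<le> ennreal K * (?F Q x + ennreal (T Q))"
        unfolding K_def T_def
      proof (rule inner_int_union_le[where xp = xp])
        show "\<exists>ch. is_chain U ch Q S \<and> set ch \<subseteq> linking_cubes U C e Q S" if "S \<in> V" for S
          by (rule linkU[OF Q that])
        show "?F P (xp P) \<le> ennreal (h P)" if "P \<in> U" for P
          using hx[OF subsetD[OF UW that]] by simp
        show "(\<integral>\<^sup>+y\<in>ocube P. ?F P y \<partial>lebesgue) = ennreal (h P * side P powr ?d)" if "P \<in> U" for P
          using hx[OF subsetD[OF UW that]] by simp
        show "xp P \<in> ocube P" if "P \<in> U" for P
          using hx[OF subsetD[OF UW that]] by simp
        show "ocube P \<subseteq> \<Omega>" if "P \<in> U" for P
          by (rule sub[OF subsetD[OF UW that]])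
        show "side P / 2 \<le> side S" if "P \<in> U" "S \<in> U" "ocube S \<subseteq> ocube (dil 5 P)" for P S
          using whit[OF subsetD[OF UW that(1)] subsetD[OF UW that(2)] that(3)] .
        show "Q \<in> U" using Q VU by auto
      qed (use f s q C e dcU VU x \<Omega> hU in simp_all)
      then have "enn_powr (?G x) r \<le> enn_powr (ennreal K * (?F Q x + ennreal (T Q))) r"
        using r by (intro enn_powr_mono) auto
      also have "\<dots> = ennreal (K powr r) * enn_powr (?F Q x + ennreal (T Q)) r"
        using K r by (intro enn_powr_cmult) auto
      also have "\<dots> \<le> ennreal (K powr r) * (ennreal (2 powr r) * (enn_powr (?F Q x) r + enn_powr (ennreal (T Q)) r))"
        using r by (intro mult_left_mono enn_powr_add_le) auto
      also have "\<dots> = ennreal (K powr r * 2 powr r) * (enn_powr (?F Q x) r + ennreal (T Q powr r))"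
        using T0 by (simp add: ennreal_mult mult.assoc)
      also have "K powr r * 2 powr r = (2 * K) powr r"
        using K by (simp add: powr_mult)
      finally show ?thesis .
    qed
    have "(\<integral>\<^sup>+x\<in>(\<Union>S\<in>V. ocube S). enn_powr (?G x) r \<partial>lebesgue)
       \<le> (\<integral>\<^sup>+x. (\<Sum>Q\<in>V. ennreal ((2 * K) powr r) * (enn_powr (?F Q x) r * indicator (ocube Q) x + ennreal (T Q powr r) * indicator (ocube Q) x)) \<partial>lebesgue)"
    proof (intro nn_integral_mono)
      fix x
      show "enn_powr (?G x) r * indicator (\<Union>S\<in>V. ocube S) x
        \<le> (\<Sum>Q\<in>V. ennreal ((2 * K) powr r) * (enn_powr (?F Q x) r * indicator (ocube Q) x + ennreal (T Q powr r) * indicator (ocube Q) x))"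
        (is "_ \<le> sum ?t V")
      proof (cases "x \<in> (\<Union>S\<in>V. ocube S)")
        case True
        then obtain Q where Q: "Q \<in> V" "x \<in> ocube Q" by auto
        have "enn_powr (?G x) r * indicator (\<Union>S\<in>V. ocube S) x \<le> ?t Q"
          using pt[OF Q] True Q by simp
        also have "\<dots> \<le> sum ?t V" using Q V by (intro member_le_sum) auto
        finally show ?thesis .
      qed simp
    qed
    also have "\<dots> = (\<Sum>Q\<in>V. ennreal ((2 * K) powr r) * (I Q + ennreal (T Q powr r * side Q powr ?d)))"
    proof (subst nn_integral_sum, force, intro sum.cong refl)
      fix Q assume "Q \<in> V"
      then have Q: "0 < side Q" by (intro pos subsetD[OF V(2)])
      show "(\<integral>\<^sup>+x. ennreal ((2 * K) powr r) * (enn_powr (?F Q x) r * indicator (ocube Q) x + ennreal (T Q powr r) * indicator (ocube Q) x) \<partial>lebesgue)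
        = ennreal ((2 * K) powr r) * (I Q + ennreal (T Q powr r * side Q powr ?d))"
        using emeasure_ocube[OF Q]
        by (subst nn_integral_cmult) (auto simp: nn_integral_add nn_integral_cmult_indicator I_def ennreal_mult simp del: emeasure_completion)
    qed
    also have "\<dots> = ennreal ((2 * K) powr r) * (sum I V + ennreal (\<Sum>Q\<in>V. side Q powr ?d * T Q powr r))"
      by (simp add: sum_distrib_left[symmetric] sum.distrib sum_ennreal mult.commute)
    also have "\<dots> \<le> ennreal ((2 * K) powr r) * (sum I U + ennreal Ko * sum I U)"
    proof (intro mult_left_mono add_mono)
      show "sum I V \<le> sum I U" using U VU by (intro sum_mono2) auto
      have "(\<Sum>Q\<in>V. side Q powr ?d * T Q powr r) \<le> (\<Sum>Q\<in>U. side Q powr ?d * T Q powr r)"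
        using U VU by (intro sum_mono2) auto
      also have "\<dots> \<le> Ko * (\<Sum>Q\<in>U. side Q powr ?d * h Q powr r)"
        unfolding T_def Ko_def using dcU s r hU by (intro gap_kernel_operator_bound) auto
      finally have "ennreal (\<Sum>Q\<in>V. side Q powr ?d * T Q powr r) \<le> ennreal (Ko * (\<Sum>Q\<in>U. side Q powr ?d * h Q powr r))"
        by (rule ennreal_leI)
      also have "\<dots> = ennreal Ko * (\<Sum>Q\<in>U. ennreal (h Q powr r * side Q powr ?d))"
        by (subst sum_ennreal) (simp_all add: ennreal_mult[OF Ko] sum_nonneg mult.commute)
      also have "\<dots> \<le> ennreal Ko * sum I U"
      \<comment> \<open>The Jensen part of the choice of \<open>h\<close> returns to the local
        integrals.\<close>
      proof (intro mult_left_mono sum_mono)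
        fix P assume "P \<in> U"
        then show "ennreal (h P powr r * side P powr ?d) \<le> I P"
          using hx[OF subsetD[OF UW]] by simp
      qed simp
      finally show "ennreal (\<Sum>Q\<in>V. side Q powr ?d * T Q powr r) \<le> ennreal Ko * sum I U" .
    qed simp
    also have "\<dots> = ennreal (finite_union_const ?d s q r C e) * sum I U"
      unfolding Kf using Ko by (simp add: ennreal_mult ennreal_plus distrib_right mult.assoc)
    also have "\<dots> \<le> ennreal (finite_union_const ?d s q r C e) * (\<integral>\<^sup>+Q. I Q \<partial>count_space W)"
      using U UW by (intro mult_left_mono sum_le_nn_integral_count_space) auto
    finally show ?thesis .
  qed
  then show ?thesis by (simp only: r_def I_def)
qed

subsection \<open>Exhaustion\<close>

lemma set_nn_integral_diff_negligible:
  assumes "B \<subseteq> A" "negligible (A - B)"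
  shows "(\<integral>\<^sup>+x\<in>A. g x \<partial>lebesgue) = (\<integral>\<^sup>+x\<in>B. g x \<partial>lebesgue)"
proof (rule nn_integral_cong_AE)
  have "AE x in lebesgue. x \<notin> A - B"
    using assms(2) by (intro AE_not_in) (simp add: negligible_iff_null_sets)
  then show "AE x in lebesgue. g x * indicator A x = g x * indicator B x"
    by eventually_elim (use assms(1) in \<open>auto simp: indicator_def\<close>)
qed

lemma inner_int_exhaustion:
  fixes f :: "'a::euclidean_space \<Rightarrow> real"
  assumes f: "f \<in> borel_measurable lebesgue" and A: "\<And>n. A n \<in> sets lebesgue" "incseq A"
  shows "inner_int f s q (\<Union>n. A n) x = (SUP n. inner_int f s q (A n) x)"
proof -
  let ?k = "\<lambda>y. ennreal (\<bar>f x - f y\<bar> powr q / norm (x - y) powr (s * q + real DIM('a)))"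
  have "(\<integral>\<^sup>+y. (SUP n. ?k y * indicator (A n) y) \<partial>lebesgue) = (SUP n. \<integral>\<^sup>+y. ?k y * indicator (A n) y \<partial>lebesgue)"
  proof (rule nn_integral_monotone_convergence_SUP)
    show "incseq (\<lambda>n y. ?k y * indicator (A n) y)"
      using A(2) by (force simp: incseq_def le_fun_def split: split_indicator)
    show "(\<lambda>y. ?k y * indicator (A n) y) \<in> borel_measurable lebesgue" for n
      using kernel_measurable[OF f, of x q] A(1)[of n] by measurable
  qed
  moreover have "(SUP n. ?k y * indicator (A n) y) = ?k y * indicator (\<Union>n. A n) y" for y
  proof (cases "y \<in> (\<Union>n. A n)")
    case True
    then obtain n where n: "y \<in> A n" by auto
    have "?k y \<le> (SUP n. ?k y * indicator (A n) y)"
      using n by (intro SUP_upper2[of n]) auto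
    moreover have "(SUP n. ?k y * indicator (A n) y) \<le> ?k y"
      by (intro SUP_least) (auto split: split_indicator)
    ultimately show ?thesis using True by (simp add: antisym)
  qed simp
  ultimately show ?thesis by (simp add: inner_int_def)
qed

text \<open>The outer and the inner domain grow with the same index, so the limit is taken along the
  diagonal of two exhaustions.\<close>

lemma double_integral_exhaustion_le:
  fixes f :: "'a::euclidean_space \<Rightarrow> real"
  assumes f: "f \<in> borel_measurable lebesgue" and A: "\<And>n. A n \<in> sets lebesgue" "incseq A" and r: "0 < r"
    and bound: "\<And>n. (\<integral>\<^sup>+x\<in>A n. enn_powr (inner_int f s q (A n) x) r \<partial>lebesgue) \<le> B"
  shows "(\<integral>\<^sup>+x\<in>(\<Union>n. A n). enn_powr (inner_int f s q (\<Union>n. A n) x) r \<partial>lebesgue) \<le> B"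
proof -
  let ?g = "\<lambda>n x. enn_powr (inner_int f s q (A n) x) r * indicator (A n) x"
  have inc: "incseq ?g"
  proof (intro incseq_SucI le_funI)
    fix n x
    show "?g n x \<le> ?g (Suc n) x"
      using incseq_SucD[OF A(2), of n] r
      by (auto split: split_indicator intro!: enn_powr_mono inner_int_mono)
  qed
  have "(\<integral>\<^sup>+x\<in>(\<Union>n. A n). enn_powr (inner_int f s q (\<Union>n. A n) x) r \<partial>lebesgue) \<le> (\<integral>\<^sup>+x. (SUP n. ?g n x) \<partial>lebesgue)"
  proof (intro nn_integral_mono)
    fix x
    show "enn_powr (inner_int f s q (\<Union>n. A n) x) r * indicator (\<Union>n. A n) x \<le> (SUP n. ?g n x)"
    proof (cases "x \<in> (\<Union>n. A n)")
      case True
      then obtain N where N: "x \<in> A N" by auto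
      have "enn_powr (inner_int f s q (\<Union>n. A n) x) r \<le> (SUP n. ?g n x)"
        unfolding inner_int_exhaustion[OF f A]
      proof (rule enn_powr_SUP_le[OF r])
        fix i
        \<comment> \<open>The index max i N serves both purposes: its set contains \<open>x\<close>
          and contains the inner domain \<open>A i\<close>.\<close>
        have sub: "A i \<subseteq> A (max i N)" "x \<in> A (max i N)"
          using incseqD[OF A(2), of i "max i N"] incseqD[OF A(2), of N "max i N"] N by auto
        have "enn_powr (inner_int f s q (A i) x) r \<le> ?g (max i N) x"
          using sub r by (auto intro!: enn_powr_mono inner_int_mono)
        also have "\<dots> \<le> (SUP n. ?g n x)" by (rule SUP_upper) simp
        finally show "enn_powr (inner_int f s q (A i) x) r \<le> (SUP n. ?g n x)" .
      qed
      then show ?thesis using True by simp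
    qed simp
  qed
  also have "\<dots> = (SUP n. \<integral>\<^sup>+x. ?g n x \<partial>lebesgue)"
  proof (rule nn_integral_monotone_convergence_SUP[OF inc])
    show "?g n \<in> borel_measurable lebesgue" for n
      using inner_int_measurable[OF f A(1), of s q n] A(1)[of n] by measurable
  qed
  also have "\<dots> \<le> B" using bound by (rule SUP_least)
  finally show ?thesis .
qed

lemma inner_int_cong_on:
  assumes "\<And>y. y \<in> A \<Longrightarrow> f y = g y" "f x = g x"
  shows "inner_int f s q A x = inner_int g s q A x"
  unfolding inner_int_def using assms by (intro nn_integral_cong) (simp split: split_indicator)

lemma ccube_diff_ocube_negligible: "negligible (ccube Q - ocube Q)"
  unfolding ccube_eq_cbox ocube_eq_box by (rule negligible_frontier_interval)

section \<open>Consequences of the covering conditions\<close>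

lemma whitney_cubes_pos:
  assumes "whitney_covering \<Omega> W" "P \<in> W"
  shows "0 < side P"
  using assms by (auto simp: whitney_covering_def dyadic_def side_def)

lemma whitney_countable:
  fixes W :: "('a::euclidean_space \<times> real) set"
  assumes wc: "whitney_covering \<Omega> W"
  shows "countable W"
proof -
  have disj: "\<And>P S. P \<in> W \<Longrightarrow> S \<in> W \<Longrightarrow> P \<noteq> S \<Longrightarrow> ocube P \<inter> ocube S = {}"
    using wc by (auto simp: whitney_covering_def)
  have "inj_on ocube W"
  proof (rule inj_onI, rule ccontr)
    fix P S assume PS: "P \<in> W" "S \<in> W" "ocube P = ocube S" "P \<noteq> S"
    then show False
      using disj[OF PS(1,2,4)] center_in_ocube[OF whitney_cubes_pos[OF wc PS(1)]] by auto
  qed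
  moreover have "countable (ocube ` W)"
  proof (rule countable_disjoint_open_subsets)
    show "pairwise disjnt (ocube ` W)"
    proof (rule pairwiseI)
      fix A B assume "A \<in> ocube ` W" "B \<in> ocube ` W" "A \<noteq> B"
      then obtain P S where "P \<in> W" "S \<in> W" "A = ocube P" "B = ocube S" "P \<noteq> S" by blast
      then show "disjnt A B" using disj[of P S] by (simp add: disjnt_def)
    qed
  qed auto
  ultimately show ?thesis by (simp add: countable_image_inj_eq)
qed

lemma whitney_ccube_subset: "whitney_covering \<Omega> W \<Longrightarrow> P \<in> W \<Longrightarrow> ccube P \<subseteq> \<Omega>"
  unfolding whitney_covering_def by blast

text \<open>Closed cubes are compact in \<Omega> and countably many of them cover it. Local
  integrability makes \<open>f\<close> measurable on each, and the pieces are glued with the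
  complement, where the extension is zero.\<close>

lemma L1_loc_measurable_extension:
  fixes f :: "'a::euclidean_space \<Rightarrow> real"
  assumes f: "L1_loc \<Omega> f" and wc: "whitney_covering \<Omega> W" and \<Omega>: "\<Omega> \<in> sets lebesgue"
  shows "(\<lambda>x. if x \<in> \<Omega> then f x else 0) \<in> borel_measurable lebesgue"
proof (rule measurable_piecewise_restrict[where C = "insert (- \<Omega>) (ccube ` W)"])
  show "countable (insert (- \<Omega>) (ccube ` W))" using whitney_countable[OF wc] by simp
  show "space lebesgue \<subseteq> \<Union> (insert (- \<Omega>) (ccube ` W))"
    using wc by (auto simp: whitney_covering_def)
  have meas: "A \<in> sets lebesgue" if "A \<in> insert (- \<Omega>) (ccube ` W)" for A
    using that \<Omega> by (auto simp: ccube_eq_cbox sets.compl_sets[of \<Omega> lebesgue, simplified] Compl_eq_Diff_UNIV)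
  then show "A \<inter> space lebesgue \<in> sets lebesgue" if "A \<in> insert (- \<Omega>) (ccube ` W)" for A
    using that by simp
  fix A assume A: "A \<in> insert (- \<Omega>) (ccube ` W)"
  have "(\<lambda>x. indicator A x *\<^sub>R (if x \<in> \<Omega> then f x else 0)) \<in> borel_measurable lebesgue"
  proof (cases "A = - \<Omega>")
    case True
    then have "(\<lambda>x. indicator A x *\<^sub>R (if x \<in> \<Omega> then f x else 0)) = (\<lambda>x. 0)"
      by (auto simp: indicator_def)
    then show ?thesis by simp
  next
    case False
    then obtain P where P: "P \<in> W" "A = ccube P" using A by auto
    then have sub: "A \<subseteq> \<Omega>" using whitney_ccube_subset[OF wc] by simp
    then have "set_integrable lebesgue A f"
      using f compact_ccube[of P] unfolding L1_loc_def P(2) by blast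
    then have "(\<lambda>x. indicator A x *\<^sub>R f x) \<in> borel_measurable lebesgue"
      unfolding set_integrable_def by (rule borel_measurable_integrable)
    also have "(\<lambda>x. indicator A x *\<^sub>R f x) = (\<lambda>x. indicator A x *\<^sub>R (if x \<in> \<Omega> then f x else 0))"
      using sub by (auto simp: fun_eq_iff split: split_indicator)
    finally show ?thesis .
  qed
  then show "(\<lambda>x. if x \<in> \<Omega> then f x else 0) \<in> borel_measurable (restrict_space lebesgue A)"
    using meas[OF A] by (subst borel_measurable_restrict_space_iff) auto
qed

text \<open>Sum and integral are exchanged by Tonelli's theorem. By disjointness at most one cube
  contributes at each point, so the constant is 1.\<close>

lemma whitney_local_le_global:
  fixes f :: "'a::euclidean_space \<Rightarrow> real"
  assumes f: "f \<in> borel_measurable lebesgue" and wc: "whitney_covering \<Omega> W" and \<Omega>: "\<Omega> \<in> sets lebesgue"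
    and r: "0 < r"
  shows "(\<integral>\<^sup>+Q. (\<integral>\<^sup>+x\<in>ocube Q. enn_powr (inner_int f s q (ocube (dil 5 Q) \<inter> \<Omega>) x) r \<partial>lebesgue) \<partial>count_space W)
    \<le> (\<integral>\<^sup>+x\<in>\<Omega>. enn_powr (inner_int f s q \<Omega> x) r \<partial>lebesgue)"
proof -
  let ?g = "\<lambda>Q x. enn_powr (inner_int f s q (ocube (dil 5 Q) \<inter> \<Omega>) x) r * indicator (ocube Q) x"
  have disj: "\<And>P S. P \<in> W \<Longrightarrow> S \<in> W \<Longrightarrow> P \<noteq> S \<Longrightarrow> ocube P \<inter> ocube S = {}"
    using wc by (auto simp: whitney_covering_def)
  have "(\<integral>\<^sup>+Q. (\<integral>\<^sup>+x. ?g Q x \<partial>lebesgue) \<partial>count_space W) = (\<integral>\<^sup>+x. (\<integral>\<^sup>+Q. ?g Q x \<partial>count_space W) \<partial>lebesgue)"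
  proof (rule nn_integral_count_space_nn_integral[symmetric, OF whitney_countable[OF wc]])
    fix Q
    have [measurable]: "inner_int f s q (ocube (dil 5 Q) \<inter> \<Omega>) \<in> borel_measurable lebesgue"
      using \<Omega> by (intro inner_int_measurable f) auto
    show "?g Q \<in> borel_measurable lebesgue" by measurable
  qed
  also have "\<dots> \<le> (\<integral>\<^sup>+x\<in>\<Omega>. enn_powr (inner_int f s q \<Omega> x) r \<partial>lebesgue)"
  proof (intro nn_integral_mono)
    fix x
    show "(\<integral>\<^sup>+Q. ?g Q x \<partial>count_space W) \<le> enn_powr (inner_int f s q \<Omega> x) r * indicator \<Omega> x"
    proof (cases "\<exists>P\<in>W. x \<in> ocube P")
      case True
      then obtain P where P: "P \<in> W" "x \<in> ocube P" by auto
      have "(\<integral>\<^sup>+Q. ?g Q x \<partial>count_space W) = (\<Sum>Q\<in>{P}. ?g Q x)"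
      proof (rule nn_integral_count_space')
        show "?g Q x = 0" if Q: "Q \<in> W" "Q \<notin> {P}" for Q
        proof -
          have "x \<notin> ocube Q" using disj[OF P(1) Q(1)] Q(2) P(2) by blast
          then show ?thesis by simp
        qed
      qed (use P in auto)
      also have "\<dots> \<le> enn_powr (inner_int f s q \<Omega> x) r"
        using P r by (auto intro!: enn_powr_mono inner_int_mono)
      also have "\<dots> = enn_powr (inner_int f s q \<Omega> x) r * indicator \<Omega> x"
      proof -
        have "x \<in> \<Omega>" using whitney_ccube_subset[OF wc P(1)] mem_ocube_imp_ccube[OF P(2)] by auto
        then show ?thesis by simp
      qed
      finally show ?thesis .
    next
      case False
      then have "(\<integral>\<^sup>+Q. ?g Q x \<partial>count_space W) = (\<integral>\<^sup>+Q. 0 \<partial>count_space W)"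
        by (intro nn_integral_cong) auto
      then show ?thesis by simp
    qed
  qed
  finally show ?thesis .
qed

lemma whitney_global_le_local:
  fixes f :: "'a::euclidean_space \<Rightarrow> real"
  assumes f: "f \<in> borel_measurable lebesgue" and wc: "whitney_covering \<Omega> W" and \<Omega>: "\<Omega> \<in> sets lebesgue" "\<Omega> \<noteq> {}"
    and s: "0 < s" and q: "1 \<le> q" "q \<le> p" and C: "0 < C" and e: "0 < e"
    and link: "\<And>Q S. Q \<in> W \<Longrightarrow> S \<in> W \<Longrightarrow> \<exists>ch. is_chain W ch Q S \<and> set ch \<subseteq> linking_cubes W C e Q S"
  shows "(\<integral>\<^sup>+x\<in>\<Omega>. enn_powr (inner_int f s q \<Omega> x) (p / q) \<partial>lebesgue)
     \<le> ennreal (finite_union_const (real DIM('a)) s q (p / q) C e)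
       * (\<integral>\<^sup>+Q. (\<integral>\<^sup>+x\<in>ocube Q. enn_powr (inner_int f s q (ocube (dil 5 Q) \<inter> \<Omega>) x) (p / q) \<partial>lebesgue) \<partial>count_space W)"
proof -
  define Oc where "Oc = (\<Union>P\<in>W. ocube P)"
  \<comment> \<open>The enumeration may repeat cubes when \<open>W\<close> is finite; taking the
    union over the image set makes this harmless.\<close>
  define A where "A = (\<lambda>n. \<Union>P\<in>from_nat_into W ` {..n}. ocube P)"
  have cW: "countable W" by (rule whitney_countable[OF wc])
  have cov: "(\<Union>P\<in>W. ccube P) = \<Omega>" using wc by (simp add: whitney_covering_def)
  then have W: "W \<noteq> {}" using \<Omega> by auto
  have subc: "ocube P \<subseteq> \<Omega>" if "P \<in> W" for P
    using whitney_ccube_subset[OF wc that] mem_ocube_imp_ccube[of _ P] by blast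
  have OA: "Oc = (\<Union>n. A n)"
  proof -
    have "(\<Union>n. from_nat_into W ` {..n}) = from_nat_into W ` UNIV" by blast
    also have "\<dots> = W" by (rule range_from_nat_into[OF W cW])
    finally have "Oc = (\<Union>P\<in>(\<Union>n. from_nat_into W ` {..n}). ocube P)" by (simp only: Oc_def)
    then show ?thesis unfolding A_def by blast
  qed
  have sub: "Oc \<subseteq> \<Omega>" using subc by (auto simp: Oc_def)
  \<comment> \<open>The countably many cube boundaries form a null set, so the open cubes exhaust
    both integrals.\<close>
  have "negligible (\<Union>P\<in>W. ccube P - ocube P)"
    using cW by (intro negligible_countable_Union) (auto intro: ccube_diff_ocube_negligible)
  moreover have "\<Omega> - Oc \<subseteq> (\<Union>P\<in>W. ccube P - ocube P)"
    unfolding cov[symmetric] Oc_def by blast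
  ultimately have neg: "negligible (\<Omega> - Oc)" by (rule negligible_subset)
  have in_eq: "inner_int f s q \<Omega> x = inner_int f s q Oc x" for x
    unfolding inner_int_def by (rule set_nn_integral_diff_negligible[OF sub neg])
  have "(\<integral>\<^sup>+x\<in>\<Omega>. enn_powr (inner_int f s q \<Omega> x) (p / q) \<partial>lebesgue)
      = (\<integral>\<^sup>+x\<in>Oc. enn_powr (inner_int f s q Oc x) (p / q) \<partial>lebesgue)"
    unfolding in_eq by (rule set_nn_integral_diff_negligible[OF sub neg])
  also have "\<dots> \<le> ennreal (finite_union_const (real DIM('a)) s q (p / q) C e)
       * (\<integral>\<^sup>+Q. (\<integral>\<^sup>+x\<in>ocube Q. enn_powr (inner_int f s q (ocube (dil 5 Q) \<inter> \<Omega>) x) (p / q) \<partial>lebesgue) \<partial>count_space W)"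
    unfolding OA
  proof (rule double_integral_exhaustion_le[OF f])
    show "A n \<in> sets lebesgue" for n
      unfolding A_def by (intro sets.finite_UN) auto
    show "incseq A"
      unfolding A_def by (intro incseq_SucI UN_mono) auto
    show "0 < p / q" using q by simp
    show "(\<integral>\<^sup>+x\<in>A n. enn_powr (inner_int f s q (A n) x) (p / q) \<partial>lebesgue)
      \<le> ennreal (finite_union_const (real DIM('a)) s q (p / q) C e)
       * (\<integral>\<^sup>+Q. (\<integral>\<^sup>+x\<in>ocube Q. enn_powr (inner_int f s q (ocube (dil 5 Q) \<inter> \<Omega>) x) (p / q) \<partial>lebesgue) \<partial>count_space W)" for n
      unfolding A_def
    proof (rule finite_union_double_integral_le[OF f s q C e \<Omega>(1)])
      show "0 < side P" if "P \<in> W" for P by (rule whitney_cubes_pos[OF wc that])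
      show "ocube P \<inter> ocube S = {}" if "P \<in> W" "S \<in> W" "P \<noteq> S" for P S
        using wc that unfolding whitney_covering_def by blast
      show "side P / 2 \<le> side S" if "P \<in> W" "S \<in> W" "ocube S \<subseteq> ocube (dil 5 P)" for P S
        using wc that unfolding whitney_covering_def by blast
      show "from_nat_into W ` {..n} \<subseteq> W" using from_nat_into[OF W] by auto
    qed (fact subc link | simp)+
  qed
  finally show ?thesis .
qed

lemma uniform_domain_linking:
  fixes W :: "('a::euclidean_space \<times> real) set"
  assumes "uniform_domain \<Omega> W"
  obtains C e where "0 < C" "0 < e"
    "\<And>Q S. Q \<in> W \<Longrightarrow> S \<in> W \<Longrightarrow> \<exists>ch. is_chain W ch Q S \<and> set ch \<subseteq> linking_cubes W C e Q S"
proof -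
  have wc: "whitney_covering \<Omega> W" using assms by (simp add: uniform_domain_def)
  obtain \<epsilon> where \<epsilon>: "0 < \<epsilon>" "\<And>Q S. Q \<in> W \<Longrightarrow> S \<in> W \<Longrightarrow> \<exists>ch. admissible_chain \<epsilon> W ch Q S"
    using assms unfolding uniform_domain_def by blast
  show ?thesis
  proof (rule that)
    show "0 < (real DIM('a) + 2) / \<epsilon>" "0 < \<epsilon> / (real DIM('a) + 1)"
      using \<epsilon>(1) by (simp_all add: add_nonneg_pos)
    fix Q S assume QS: "Q \<in> W" "S \<in> W"
    obtain ch where ch: "admissible_chain \<epsilon> W ch Q S" using \<epsilon>(2)[OF QS] by auto
    have "P \<in> linking_cubes W ((real DIM('a) + 2) / \<epsilon>) (\<epsilon> / (real DIM('a) + 1)) Q S" if "P \<in> set ch" for P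
    proof -
      have "set ch \<subseteq> W" using ch unfolding admissible_chain_def is_chain_def by blast
      then show ?thesis
        using that admissible_chain_cube_gap[OF ch whitney_cubes_pos[OF wc] \<epsilon>(1) that]
        unfolding linking_cubes_def by blast
    qed
    moreover have "is_chain W ch Q S" using ch by (simp add: admissible_chain_def)
    ultimately show "\<exists>ch. is_chain W ch Q S \<and> set ch \<subseteq> linking_cubes W ((real DIM('a) + 2) / \<epsilon>) (\<epsilon> / (real DIM('a) + 1)) Q S"
      by blast
  qed
qed

theorem theoremA3:
  fixes \<Omega> :: "'a::euclidean_space set" and W :: "('a \<times> real) set"
    and s p q :: real
  assumes "uniform_domain \<Omega> W"
    and "0 < s" "s < 1" "1 \<le> q" "q \<le> p"
  shows "\<exists>C>0. \<forall>f :: 'a \<Rightarrow> real. L1_loc \<Omega> f \<longrightarrow>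
     (let LHS = enn_powr (\<integral>\<^sup>+ Q. set_nn_integral lebesgue (ocube Q)
                   (\<lambda>x. enn_powr (inner_int f s q (ocube (dil 5 Q) \<inter> \<Omega>) x) (p / q))
                 \<partial>count_space W) (1 / p);
          RHS = enn_powr (set_nn_integral lebesgue \<Omega>
                   (\<lambda>x. enn_powr (inner_int f s q \<Omega> x) (p / q))) (1 / p)
      in LHS \<le> ennreal C * RHS \<and> RHS \<le> ennreal C * LHS)"
proof -
  have wc: "whitney_covering \<Omega> W" and op: "open \<Omega>" and ne: "\<Omega> \<noteq> {}"
    using assms(1) by (simp_all add: uniform_domain_def)
  have \<Omega>: "\<Omega> \<in> sets lebesgue" using op by auto
  have p: "0 < p" "0 < p / q" using assms by simp_all
  obtain C e where Ce: "0 < C" "0 < e"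
    and link: "\<And>Q S. Q \<in> W \<Longrightarrow> S \<in> W \<Longrightarrow> \<exists>ch. is_chain W ch Q S \<and> set ch \<subseteq> linking_cubes W C e Q S"
    using uniform_domain_linking[OF assms(1)] by blast
  define K where "K = finite_union_const (real DIM('a)) s q (p / q) C e"
  have K: "0 < K"
  proof -
    have "0 < pointwise_const (real DIM('a)) s q C e"
      using pointwise_const_ge_1[of s q "real DIM('a)" C e] assms by simp
    then show ?thesis
      unfolding K_def finite_union_const_def by (intro mult_pos_pos add_pos_nonneg) auto
  qed
  \<comment> \<open>One constant for both inequalities: 1 for local by global, the p-th root of
    \<open>K\<close> for the converse.\<close>
  define K' where "K' = 1 + K powr (1 / p)"
  have K': "1 \<le> K'" "K powr (1 / p) \<le> K'" by (simp_all add: K'_def)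
  show ?thesis
  proof (intro exI[of _ K'] conjI allI impI)
    show "0 < K'" using K' by simp
    fix f :: "'a \<Rightarrow> real" assume f: "L1_loc \<Omega> f"
    \<comment> \<open>Both sides see \<open>f\<close> only on \<Omega>, so it may be replaced by its
      measurable extension by zero.\<close>
    define f' where "f' = (\<lambda>x. if x \<in> \<Omega> then f x else 0)"
    have f': "f' \<in> borel_measurable lebesgue"
      unfolding f'_def by (rule L1_loc_measurable_extension[OF f wc \<Omega>])
    have ii: "inner_int f s q A x = inner_int f' s q A x" if "A \<subseteq> \<Omega>" "x \<in> \<Omega>" for A x
      using that by (intro inner_int_cong_on) (auto simp: f'_def)
    define L where "L = (\<integral>\<^sup>+ Q. set_nn_integral lebesgue (ocube Q)
                   (\<lambda>x. enn_powr (inner_int f s q (ocube (dil 5 Q) \<inter> \<Omega>) x) (p / q)) \<partial>count_space W)"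
    define R where "R = set_nn_integral lebesgue \<Omega> (\<lambda>x. enn_powr (inner_int f s q \<Omega> x) (p / q))"
    have L: "L = (\<integral>\<^sup>+ Q. set_nn_integral lebesgue (ocube Q)
                   (\<lambda>x. enn_powr (inner_int f' s q (ocube (dil 5 Q) \<inter> \<Omega>) x) (p / q)) \<partial>count_space W)"
      unfolding L_def
    proof (intro nn_integral_cong)
      fix Q x assume "Q \<in> space (count_space W)"
      then have Q: "Q \<in> W" by simp
      show "enn_powr (inner_int f s q (ocube (dil 5 Q) \<inter> \<Omega>) x) (p / q) * indicator (ocube Q) x
          = enn_powr (inner_int f' s q (ocube (dil 5 Q) \<inter> \<Omega>) x) (p / q) * indicator (ocube Q) x"
      proof (cases "x \<in> ocube Q")
        case True
        then have "x \<in> \<Omega>" using whitney_ccube_subset[OF wc Q] mem_ocube_imp_ccube[OF True] by auto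
        then show ?thesis by (simp add: ii)
      qed simp
    qed
    have R: "R = set_nn_integral lebesgue \<Omega> (\<lambda>x. enn_powr (inner_int f' s q \<Omega> x) (p / q))"
      unfolding R_def by (intro nn_integral_cong) (simp add: ii split: split_indicator)
    have LR: "L \<le> R"
      unfolding L R by (rule whitney_local_le_global[OF f' wc \<Omega> p(2)])
    have RL: "R \<le> ennreal K * L"
      unfolding L R K_def using assms by (intro whitney_global_le_local[OF f' wc \<Omega> ne _ _ _ Ce link]) auto
    have "enn_powr L (1 / p) \<le> 1 * enn_powr R (1 / p)"
      using LR p by (simp add: enn_powr_mono)
    also have "\<dots> \<le> ennreal K' * enn_powr R (1 / p)"
      using K' by (intro mult_right_mono) auto
    finally have one: "enn_powr L (1 / p) \<le> ennreal K' * enn_powr R (1 / p)" .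
    have "enn_powr R (1 / p) \<le> enn_powr (ennreal K * L) (1 / p)"
      using RL p by (intro enn_powr_mono) auto
    also have "\<dots> = ennreal (K powr (1 / p)) * enn_powr L (1 / p)"
      using K p by (intro enn_powr_cmult) auto
    also have "\<dots> \<le> ennreal K' * enn_powr L (1 / p)"
      using K' by (intro mult_right_mono ennreal_leI) auto
    finally have two: "enn_powr R (1 / p) \<le> ennreal K' * enn_powr L (1 / p)" .
    show "let LHS = enn_powr (\<integral>\<^sup>+ Q. set_nn_integral lebesgue (ocube Q)
                   (\<lambda>x. enn_powr (inner_int f s q (ocube (dil 5 Q) \<inter> \<Omega>) x) (p / q))
                 \<partial>count_space W) (1 / p);
          RHS = enn_powr (set_nn_integral lebesgue \<Omega>
                   (\<lambda>x. enn_powr (inner_int f s q \<Omega> x) (p / q))) (1 / p)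
      in LHS \<le> ennreal K' * RHS \<and> RHS \<le> ennreal K' * LHS"
      using one two unfolding Let_def L_def R_def by blast
  qed
qed

end
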